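(* Let $t\ge1$ be an integer and $g=2t$. Let $\lambda\in\mathcal{DD}_{g}^{'1}$, let $\mathbf{v}\in\mathbb{Z}^t$ be its $V_{g,t}$-coding, and set $r_i=v_i-g/2+1$ for $1\le i\le t$. Then $$|\lambda| = \frac{1}{g}\sum_{i=1}^{t} r_i^2-\frac{(g+1)(g/2 +1)}{12}.$$ Moreover, setting $\alpha_i(\lambda)=\#\{s\in\lambda\mid h_s=g-i,\ \varepsilon_s=1\}$, for any field $F$ and any function $\tau:\mathbb{Z}\to F^{\times}$, $$\prod_{s\in\lambda}\frac{\tau(h_s-\varepsilon_s g)}{\tau(h_s)}=\prod_{i=1}^{g-1}\left(\frac{\tau(-i)}{\tau(i)}\right)^{\alpha_i(\lambda)}\prod_{i=1}^{t}\frac{\tau(r_i)}{\tau(i)}\prod_{1\le i<j\le t} \frac{\tau(r_i-r_j)}{\tau(j-i)}\, \frac{\tau(r_i+r_j)}{\tau(g+2-i-j)}.$$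
   Context: For a partition $\lambda$, $h_s$ is the hook length of a box $s$, $d_\lambda=\max\{s:\lambda_s\ge s\}$, and $\varepsilon_s=-1$ if $s$ is strictly below the main diagonal of the Ferrers diagram (English convention), $\varepsilon_s=1$ otherwise. $\mathcal{DD}$ is the set of partitions with $\lambda_i=\lambda'_i+1$ for $1\le i\le d_\lambda$ ($\lambda'$ the conjugate; the empty partition included), and $\mathcal{DD}'=\{\lambda'\mid\lambda\in\mathcal{DD}\}$. Word of a partition: $\psi(\lambda)=(c_k)_{k\in\mathbb{Z}}\in\{0,1\}^{\mathbb{Z}}$ encodes the border of the Ferrers diagram read from South-West to North-East ($0$ vertical step, $1$ horizontal step), indexed so that $\#\{k\le -1: c_k=1\}=\#\{k\ge 0: c_k=0\}$; equivalently $c_k=0$ iff $k=\lambda_i-i$ for some $i\ge1$ (with $\lambda_i=0$ beyond the length). The $g$-quotient of $\lambda$ is $(\nu^{(0)},\dots,\nu^{(g-1)})$, where $\nu^{(k)}$ is the partition whose word is, up to a shift of indices, the subword $(c_{gi+k})_{i\in\mathbb{Z}}$. $\mathcal{DD}_{2t}^{'1}$ is the set of $\lambda\in\mathcal{DD}'$ whose $2t$-quotient satisfies $\nu^{(k)}=\emptyset$ for all $k\ne 2t-1$ and $\nu^{(2t-1)}$ is, for some integer $m_1\ge 1$, the rectangular partition with $m_1$ parts all equal to $m_1-1$ (empty if $m_1=1$). $V_{g,t}$-coding: for $i\in\{0,\dots,g-1\}$ let $\beta_i=\max\{(k+1)g+i\mid k\in\mathbb{Z},\ c_{kg+i}=0\}$;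 the $V_{g,t}$-coding is $\mathbf{v}=(v_1>\dots>v_t)$, the $t$ largest of the distinct integers $\beta_0,\dots,\beta_{g-1}$ in decreasing order. *)

theory Defs
  imports Complex_Main
begin

text \<open>A partition is the weakly decreasing list of its nonzero parts. Parts, rows and columns are
  numbered from 1, and \<open>part lam i = 0\<close> beyond the length.\<close>

definition is_partition :: "nat list \<Rightarrow> bool" where
  "is_partition lam \<longleftrightarrow> sorted_wrt (\<ge>) lam \<and> 0 \<notin> set lam"

definition part :: "nat list \<Rightarrow> nat \<Rightarrow> nat" where
  "part lam i = (if 1 \<le> i \<and> i \<le> length lam then lam ! (i - 1) else 0)"

definition conjugate :: "nat list \<Rightarrow> nat list" where
  "conjugate lam = map (\<lambda>j. card {i. 1 \<le> i \<and> j \<le> part lam i}) [1..<Suc (part lam 1)]"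

text \<open>English convention: \<open>(i, j)\<close> is the box in row \<open>i\<close> and column \<open>j\<close>, rows going downwards.\<close>

definition boxes :: "nat list \<Rightarrow> (nat \<times> nat) set" where
  "boxes lam = {(i, j). 1 \<le> i \<and> 1 \<le> j \<and> j \<le> part lam i}"

fun hook :: "nat list \<Rightarrow> nat \<times> nat \<Rightarrow> (nat \<times> nat) set" where
  "hook lam (i, j) = {(a, b) \<in> boxes lam. (a = i \<and> j \<le> b) \<or> (b = j \<and> i \<le> a)}"

definition hook_length :: "nat list \<Rightarrow> nat \<times> nat \<Rightarrow> nat" where
  "hook_length lam s = card (hook lam s)"

fun eps :: "nat \<times> nat \<Rightarrow> int" where
  "eps (i, j) = (if i > j then - 1 else 1)"

text \<open>Inserting 0 gives the empty partition the value 0.\<close>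

definition durfee :: "nat list \<Rightarrow> nat" where
  "durfee lam = Max (insert 0 {s. 1 \<le> s \<and> s \<le> part lam s})"

definition DD :: "nat list set" where
  "DD = {lam. is_partition lam \<and>
    (\<forall>i. 1 \<le> i \<and> i \<le> durfee lam \<longrightarrow> part lam i = part (conjugate lam) i + 1)}"

definition DD' :: "nat list set" where
  "DD' = conjugate ` DD"

definition word :: "nat list \<Rightarrow> int \<Rightarrow> nat" where
  "word lam k = (if \<exists>i\<ge>1. k = int (part lam i) - int i then 0 else 1)"

text \<open>\<open>is_quotient g lam \<nu>\<close>: the list \<open>\<nu>\<close> is the \<open>g\<close>-quotient of \<open>lam\<close>. The integer \<open>m\<close> is the
  shift of indices; since a partition is determined by its word up to a shift, \<open>lam\<close> has exactly
  one \<open>g\<close>-quotient when \<open>g \<ge> 1\<close>.\<close>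

definition is_quotient :: "nat \<Rightarrow> nat list \<Rightarrow> nat list list \<Rightarrow> bool" where
  "is_quotient g lam \<nu> \<longleftrightarrow> length \<nu> = g \<and>
    (\<forall>k<g. is_partition (\<nu> ! k) \<and>
      (\<exists>m::int. \<forall>i::int. word (\<nu> ! k) i = word lam (int g * (i + m) + int k)))"

definition rectangle :: "nat \<Rightarrow> nat \<Rightarrow> nat list" where
  "rectangle m n = (if n = 0 then [] else replicate m n)"

definition DD1' :: "nat \<Rightarrow> nat list set" where
  "DD1' g = {lam \<in> DD'. \<exists>\<nu>. is_quotient g lam \<nu> \<and>
    (\<forall>k<g. k \<noteq> g - 1 \<longrightarrow> \<nu> ! k = []) \<and>
    (\<exists>m\<ge>1. \<nu> ! (g - 1) = rectangle m (m - 1))}"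

text \<open>\<open>GREATEST\<close> rather than \<open>Max\<close>: the set of candidates is bounded above but infinite.\<close>

definition beta :: "nat \<Rightarrow> nat list \<Rightarrow> nat \<Rightarrow> int" where
  "beta g lam i =
    (GREATEST b. \<exists>k::int. b = (k + 1) * int g + int i \<and> word lam (k * int g + int i) = 0)"

text \<open>The entry \<open>v\<^sub>i\<close> of the coding is \<open>V_coding g t lam ! (i - 1)\<close>.\<close>

definition V_coding :: "nat \<Rightarrow> nat \<Rightarrow> nat list \<Rightarrow> int list" where
  "V_coding g t lam = take t (rev (sorted_list_of_set (beta g lam ` {0..<g})))"

definition alpha :: "nat \<Rightarrow> nat list \<Rightarrow> nat \<Rightarrow> nat" where
  "alpha g lam i =
    card {s \<in> boxes lam. int (hook_length lam s) = int g - int i \<and> eps s = 1}"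

end

theory Submission
  imports Defs
begin

text \<open>Shifting the beta numbers by one, \<open>Y = {\<lambda>\<^sub>i - i + 1}\<close>, turns membership in \<open>DD'\<close> into
  antisymmetry: \<open>0 \<in> Y\<close>, and for \<open>y \<noteq> 0\<close> exactly one of \<open>y\<close>, \<open>- y\<close> lies in \<open>Y\<close>. Boxes become pairs
  \<open>(y, w)\<close> with \<open>y \<in> Y\<close>, \<open>w \<in> Y - {0}\<close>, \<open>y + w > 0\<close>; the hook length is \<open>y + w\<close>, and \<open>\<epsilon> = - 1\<close> iff
  \<open>y < w\<close>. The factors with \<open>\<alpha>\<^sub>i\<close> account exactly for replacing \<open>\<tau>\<close> by the even function
  \<open>\<sigma> k = \<tau> \<bar>k\<bar>\<close>. For even \<open>\<sigma>\<close> one removes the largest element \<open>d\<close> of \<open>Y\<close> in favour of \<open>- d\<close> (the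
  principal hook of \<open>\<lambda>\<close>), which replaces the largest \<open>r\<close>, equal to \<open>d + t\<close>, by \<open>\<bar>r - g\<bar>\<close>. The
  product changes by \<open>\<sigma> (a + g) \<sigma> (a - g) / \<sigma> (a)\<^sup>2\<close> over \<open>a = d + w\<close>, \<open>w \<in> Y\<close>, up to a correction
  at \<open>w = 0\<close> and \<open>w = d\<close>; along each residue class modulo \<open>g\<close> this telescopes to the change of the
  Vandermonde-like product in the \<open>r\<^sub>i\<close>.\<close>

subsection \<open>Antisymmetric beta sets\<close>

text \<open>For a set \<open>D\<close> of positive integers, \<open>insert 0 (anti D)\<close> is the beta set
  \<open>{\<lambda>\<^sub>i - i + 1}\<close> of the partition in \<open>DD'\<close> with positive beta numbers \<open>D\<close>.\<close>

definition anti :: "int set \<Rightarrow> int set" where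
  "anti D = {y. if y > 0 then y \<in> D else y < 0 \<and> - y \<notin> D}"

text \<open>The pair \<open>(y, w)\<close> stands for the box whose row has beta number \<open>y\<close> and whose column ends
  at the gap \<open>- w\<close>; its hook length is \<open>y + w\<close>.\<close>

definition pairs :: "int set \<Rightarrow> (int \<times> int) set" where
  "pairs D = {(y, w). y \<in> insert 0 (anti D) \<and> w \<in> anti D \<and> y + w > 0}"

fun pair_sign :: "int \<times> int \<Rightarrow> int" where
  "pair_sign (y, w) = (if y < w then - 1 else 1)"

lemma anti_uminus: "w \<noteq> 0 \<Longrightarrow> - w \<in> anti D \<longleftrightarrow> w \<notin> anti D"
  by (auto simp: anti_def)

lemma anti_pos: "w > 0 \<Longrightarrow> w \<in> anti D \<longleftrightarrow> w \<in> D"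
  by (auto simp: anti_def)

lemma zero_notin_anti [simp]: "0 \<notin> anti D"
  by (auto simp: anti_def)

text \<open>For \<open>x \<noteq> 0\<close> exactly one of \<open>x\<close> and \<open>- x\<close>
  lies in \<open>anti D\<close>, so absolute value is a bijection onto
  \<open>{1..d}\<close>.\<close>

lemma card_anti_Int:
  assumes "d \<in> D" "d > 0"
  shows "card (anti D \<inter> {- d..d}) = nat d"
proof -
  have "bij_betw abs (anti D \<inter> {- d..d}) {1..d}"
    unfolding bij_betw_def
  proof
    show "inj_on abs (anti D \<inter> {- d..d})"
      by (auto simp: inj_on_def anti_def abs_if split: if_splits)
    show "abs ` (anti D \<inter> {- d..d}) = {1..d}"
    proof safe
      fix x assume "x \<in> {1..d}"
      then have "(if x \<in> D then x else - x) \<in> anti D \<inter> {- d..d}"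
        "x = \<bar>if x \<in> D then x else - x\<bar>"
        by (auto simp: anti_def)
      then show "x \<in> abs ` (anti D \<inter> {- d..d})" by blast
    next
      fix x :: int assume "x \<in> anti D" "x \<in> {- d..d}"
      then show "\<bar>x\<bar> \<in> {1..d}" by (cases "x = 0") auto
    qed
  qed
  from bij_betw_same_card[OF this] show ?thesis by simp
qed

lemma finite_pairs:
  assumes "finite D" shows "finite (pairs D)"
proof -
  define B where "B = Max (insert 0 D)"
  have B: "\<And>x. x \<in> D \<Longrightarrow> x \<le> B" "B \<ge> 0"
    using assms by (auto simp: B_def)
  have le: "x \<le> B" if "x \<in> insert 0 (anti D)" for x
    using that B by (cases "x > 0") (auto simp: anti_pos)
  have "pairs D \<subseteq> {- B..B} \<times> {- B..B}"
    unfolding pairs_def using le by fastforce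
  then show ?thesis by (rule finite_subset) auto
qed

text \<open>Passing from \<open>D\<close> to \<open>D - {d}\<close> replaces \<open>d\<close> by
  \<open>- d\<close> in \<open>anti D\<close>. By maximality of \<open>d\<close>, no pair contains
  \<open>- d\<close>, so the only effect is the loss of the pairs containing \<open>d\<close>: the
  first row \<open>y = d\<close> and the first column \<open>w = d\<close>, with the corner
  \<open>(d, d)\<close> counted in the row. Together they are the principal hook.\<close>

lemma pairs_remove_max:
  assumes d: "d \<in> D" "d > 0" and mx: "\<And>x. x \<in> D \<Longrightarrow> x \<le> d"
  defines "S \<equiv> anti D \<inter> {- d..d}"
  shows "pairs D = pairs (D - {d}) \<union> Pair d ` S \<union> (\<lambda>w. (w, d)) ` (insert 0 (S - {d}))" (is "?L = ?R")
    and "pairs (D - {d}) \<inter> Pair d ` S = {}"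
    and "(pairs (D - {d}) \<union> Pair d ` S) \<inter> (\<lambda>w. (w, d)) ` (insert 0 (S - {d})) = {}"
proof -
  have A: "w \<in> anti (D - {d}) \<longleftrightarrow> (w \<in> anti D \<and> w \<noteq> d) \<or> w = - d" for w
    using d by (auto simp: anti_def)
  have le: "x \<le> d" if "x \<in> anti D" for x
    using that mx d by (cases "x > 0") (auto simp: anti_pos)
  have d': "d \<in> anti D" "- d \<notin> anti D"
    using d by (auto simp: anti_def)
  have "(y, w) \<in> ?L \<longleftrightarrow> (y, w) \<in> ?R" for y w
  proof
    assume yw: "(y, w) \<in> pairs D"
    show "(y, w) \<in> ?R"
    proof (cases "y = d")
      case True
      then have "w \<in> S" using yw le by (auto simp: pairs_def S_def)
      then show ?thesis using True by auto
    next
      case False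
      show ?thesis
      proof (cases "w = d")
        case True
        then have "y \<in> insert 0 (S - {d})" using yw False le by (auto simp: pairs_def S_def)
        then show ?thesis using True by auto
      next
        case w: False
        then have "(y, w) \<in> pairs (D - {d})" using yw False by (auto simp: pairs_def A)
        then show ?thesis by auto
      qed
    qed
  next
    assume yw: "(y, w) \<in> ?R"
    consider "(y, w) \<in> pairs (D - {d})" | "y = d" "w \<in> S" | "w = d" "y \<in> insert 0 (S - {d})"
      using yw by auto
    then show "(y, w) \<in> pairs D"
    proof cases
      case 1
      then have "y \<noteq> - d" "w \<noteq> - d" using le d by (auto simp: pairs_def A dest!: le)
      then show ?thesis using 1 by (auto simp: pairs_def A)
    next
      case 2
      then have "w \<noteq> - d" using d' by (auto simp: S_def)
      then show ?thesis using 2 d' by (auto simp: pairs_def S_def)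
    next
      case 3
      then have "y \<noteq> - d" using d' d by (auto simp: S_def)
      then show ?thesis using 3 d' d by (auto simp: pairs_def S_def)
    qed
  qed
  then show "?L = ?R" by auto
  show "pairs (D - {d}) \<inter> Pair d ` S = {}"
    using d by (auto simp: pairs_def A)
  show "(pairs (D - {d}) \<union> Pair d ` S) \<inter> (\<lambda>w. (w, d)) ` (insert 0 (S - {d})) = {}"
    using d by (auto simp: pairs_def A)
qed

text \<open>Row and column of the principal hook contribute \<open>d\<close> boxes each: in the
  column, 0 takes the place of the corner.\<close>

lemma card_pairs_remove_max:
  assumes "finite D" "d \<in> D" "d > 0" "\<And>x. x \<in> D \<Longrightarrow> x \<le> d"
  shows "int (card (pairs D)) = int (card (pairs (D - {d}))) + 2 * d"
proof -
  define S where "S = anti D \<inter> {- d..d}"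
  have fin: "finite S" "finite (pairs (D - {d}))" using assms finite_pairs by (auto simp: S_def)
  have dS: "d \<in> S" "0 \<notin> S" using assms by (auto simp: S_def anti_pos)
  have c: "card S = nat d" using assms card_anti_Int by (simp add: S_def)
  define P Q where "P = Pair d ` S" and "Q = (\<lambda>w. (w, d)) ` (insert 0 (S - {d}))"
  have P: "card P = nat d" using c by (simp add: P_def card_image inj_on_def)
  have "card (insert 0 (S - {d})) = nat d" using c dS fin assms(3) by simp
  then have Q: "card Q = nat d" by (simp add: Q_def card_image inj_on_def del: image_insert)
  have "finite P" "finite Q" using fin by (auto simp: P_def Q_def)
  moreover note pairs_remove_max[OF assms(2-4), folded S_def, folded P_def Q_def]
  ultimately show ?thesis using P Q fin assms(3) by (simp add: card_Un_disjoint)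
qed

definition pair_prod :: "(int \<Rightarrow> 'a::field) \<Rightarrow> int \<Rightarrow> int set \<Rightarrow> 'a" where
  "pair_prod \<sigma> g D = (\<Prod>(y, w)\<in>pairs D. \<sigma> (y + w - pair_sign (y, w) * g) / \<sigma> (y + w))"

text \<open>For \<open>a = d + w\<close> with \<open>w < d\<close>, the joint contribution of the
  mirror pairs \<open>(d, w)\<close> and \<open>(w, d)\<close>, which have equal hook lengths and
  opposite signs.\<close>

definition ratio2 :: "(int \<Rightarrow> 'a::field) \<Rightarrow> int \<Rightarrow> int \<Rightarrow> 'a" where
  "ratio2 \<sigma> g a = \<sigma> (a + g) * \<sigma> (a - g) / (\<sigma> a * \<sigma> a)"

text \<open>Every \<open>w < d\<close> in \<open>anti D\<close> contributes two mirror pairs, hence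
  \<open>ratio2\<close>. The last factor corrects two exceptions: the corner \<open>(d, d)\<close>
  occurs once, with sign 1, so \<open>\<sigma> (2 * d + g) / \<sigma> (2 * d)\<close> is divided
  out; and \<open>(0, d)\<close> has no mirror pair, since 0 is not in \<open>anti D\<close>, so
  \<open>\<sigma> (d + g) / \<sigma> d\<close> is multiplied in.\<close>

lemma pair_prod_remove_max:
  fixes \<sigma> :: "int \<Rightarrow> 'a::field"
  assumes nz: "\<And>k. \<sigma> k \<noteq> 0"
    and D: "finite D" "d \<in> D" "d > 0" "\<And>x. x \<in> D \<Longrightarrow> x \<le> d"
  shows "pair_prod \<sigma> g D = pair_prod \<sigma> g (D - {d}) *
    (\<Prod>w\<in>anti D \<inter> {- d..d}. ratio2 \<sigma> g (d + w)) *
    (\<sigma> (2 * d) * \<sigma> (d + g) / (\<sigma> (2 * d + g) * \<sigma> d))"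
proof -
  define S where "S = anti D \<inter> {- d..d}"
  have fin: "finite S" "finite (pairs (D - {d}))" using D finite_pairs by (auto simp: S_def)
  have dS: "d \<in> S" "0 \<notin> S" using D by (auto simp: S_def anti_pos)
  let ?F = "\<lambda>(y, w). \<sigma> (y + w - pair_sign (y, w) * g) / \<sigma> (y + w)"
  define P Q where "P = Pair d ` S" and "Q = (\<lambda>w. (w, d)) ` (insert 0 (S - {d}))"
  have finPQ: "finite P" "finite Q" using fin by (auto simp: P_def Q_def)
  define X where "X = (\<Prod>w\<in>S. \<sigma> (d + w - g) / \<sigma> (d + w))"
  define Z where "Z = (\<Prod>w\<in>S. \<sigma> (d + w + g) / \<sigma> (d + w))"
  have "prod ?F P = X"
    unfolding X_def P_def by (subst prod.reindex) (auto simp: inj_on_def S_def intro!: prod.cong)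
  moreover have "prod ?F Q = (\<Prod>w\<in>insert 0 (S - {d}). \<sigma> (d + w + g) / \<sigma> (d + w))"
    unfolding Q_def
  proof (subst prod.reindex)
    show "prod (?F \<circ> (\<lambda>w. (w, d))) (insert 0 (S - {d})) =
        (\<Prod>w\<in>insert 0 (S - {d}). \<sigma> (d + w + g) / \<sigma> (d + w))"
      using D(3) by (intro prod.cong) (auto simp: S_def add.commute)
  qed (auto simp: inj_on_def)
  moreover have "\<dots> = \<sigma> (d + g) / \<sigma> d * (Z / (\<sigma> (2 * d + g) / \<sigma> (2 * d)))"
  proof -
    have "Z = \<sigma> (2 * d + g) / \<sigma> (2 * d) * (\<Prod>w\<in>S - {d}. \<sigma> (d + w + g) / \<sigma> (d + w))"
      unfolding Z_def using prod.remove[OF fin(1) dS(1)] by (simp only: mult_2)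
    then show ?thesis using dS fin nz by simp
  qed
  moreover have "(\<Prod>w\<in>S. ratio2 \<sigma> g (d + w)) = X * Z"
    unfolding X_def Z_def prod.distrib[symmetric] by (intro prod.cong) (auto simp: ratio2_def)
  moreover have "prod ?F (pairs D) = prod ?F (pairs (D - {d})) * prod ?F P * prod ?F Q"
    using pairs_remove_max[OF D(2-4), folded S_def, folded P_def Q_def] fin finPQ
    by (simp only: prod.union_disjoint finite_Un)
  ultimately show ?thesis
    unfolding pair_prod_def S_def[symmetric] by (simp add: mult_ac)
qed

subsection \<open>Products over residue classes\<close>

text \<open>With \<open>q a = \<sigma> a / \<sigma> (a - g)\<close> one has
  \<open>ratio2 \<sigma> g a = q (a + g) / q a\<close>.\<close>

lemma ratio2_telescope:
  fixes \<sigma> :: "int \<Rightarrow> 'a::field"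
  assumes nz: "\<And>k. \<sigma> k \<noteq> 0"
  shows "(\<Prod>k<N. ratio2 \<sigma> g (B + int k * g)) =
    \<sigma> (B + int N * g) / \<sigma> (B + int N * g - g) * (\<sigma> (B - g) / \<sigma> B)"
proof (induction N)
  case 0
  then show ?case using nz by simp
next
  case (Suc N)
  have "B + int (Suc N) * g = B + int N * g + g" by (simp add: algebra_simps)
  then show ?case using nz Suc by (simp add: ratio2_def add.assoc mult.commute)
qed

text \<open>The values \<open>d + w\<close> form a progression of step \<open>g\<close> from
  \<open>(d + M) mod g\<close> to \<open>d + M\<close>, so only the two ends of the telescoping
  product survive. The lower end depends on the residue class alone.\<close>

lemma prod_residue_class:
  fixes \<sigma> :: "int \<Rightarrow> 'a::field"
  assumes nz: "\<And>k. \<sigma> k \<noteq> 0" and g: "g > 0" and M: "M \<ge> - d - g"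
  shows "(\<Prod>w\<in>{w. - d \<le> w \<and> w \<le> M \<and> g dvd w - M}. ratio2 \<sigma> g (d + w)) =
    \<sigma> (d + M + g) / \<sigma> (d + M) * (\<sigma> ((d + M) mod g - g) / \<sigma> ((d + M) mod g))"
proof -
  define B where "B = (d + M) mod g"
  \<comment> \<open>The number of terms. The bound on \<open>M\<close> makes it nonnegative before
    \<open>nat\<close>; for \<open>- d - g \<le> M < - d\<close> it is 0 and the class is
    empty.\<close>
  define N where "N = nat ((d + M) div g + 1)"
  have "(d + M) div g \<ge> (- g) div g" using M g by (intro zdiv_mono1) auto
  then have "(d + M) div g \<ge> - 1"
    using g nonzero_mult_div_cancel_right[of g "- 1"] by simp
  then have N: "int N = (d + M) div g + 1" by (simp add: N_def)
  have eq: "d + M = B + (int N - 1) * g" by (simp add: N B_def)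
  have B: "0 \<le> B" "B < g" using g by (auto simp: B_def)
  have "bij_betw (\<lambda>k. B + int k * g - d) {..<N} {w. - d \<le> w \<and> w \<le> M \<and> g dvd w - M}"
    unfolding bij_betw_def
  proof
    show "inj_on (\<lambda>k. B + int k * g - d) {..<N}" using g by (auto simp: inj_on_def)
    show "(\<lambda>k. B + int k * g - d) ` {..<N} = {w. - d \<le> w \<and> w \<le> M \<and> g dvd w - M}"
    proof (intro set_eqI iffI)
      fix w assume "w \<in> (\<lambda>k. B + int k * g - d) ` {..<N}"
      then obtain k where k: "k < N" "w = B + int k * g - d" by auto
      have "w - M = (int k - (int N - 1)) * g" using eq k by (simp add: algebra_simps)
      then have "g dvd w - M" by simp
      moreover have "int k * g \<le> (int N - 1) * g" using k g by (intro mult_right_mono) auto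
      then have "w \<le> B + (int N - 1) * g - d"
        unfolding k(2) by (intro diff_right_mono add_left_mono)
      then have "w \<le> M" unfolding eq[symmetric] by simp
      moreover have "int k * g \<ge> 0" using g by auto
      then have "- d \<le> w" using B k by simp
      ultimately show "w \<in> {w. - d \<le> w \<and> w \<le> M \<and> g dvd w - M}" by blast
    next
      fix w assume w: "w \<in> {w. - d \<le> w \<and> w \<le> M \<and> g dvd w - M}"
      then obtain q where q: "w - M = g * q" by auto
      define k where "k = int N - 1 + q"
      have wk: "w = B + k * g - d" using eq q by (simp add: k_def algebra_simps)
      have "k * g > - 1 * g" using w B wk by auto
      then have "k > - 1" using g mult_less_cancel_right_pos by blast
      moreover have "g * q \<le> 0" using w q by auto
      then have "q \<le> 0" using g by (simp add: mult_le_0_iff)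
      ultimately have "nat k < N" "k = int (nat k)" by (auto simp: k_def)
      then show "w \<in> (\<lambda>k. B + int k * g - d) ` {..<N}" using wk
        by (metis (no_types, lifting) image_eqI lessThan_iff)
    qed
  qed
  then have "(\<Prod>w\<in>{w. - d \<le> w \<and> w \<le> M \<and> g dvd w - M}. ratio2 \<sigma> g (d + w)) =
     (\<Prod>k<N. ratio2 \<sigma> g (B + int k * g))"
    by (subst prod.reindex_bij_betw[symmetric]) (auto simp: algebra_simps)
  also have "\<dots> = \<sigma> (B + int N * g) / \<sigma> (B + int N * g - g) * (\<sigma> (B - g) / \<sigma> B)"
    using nz by (rule ratio2_telescope)
  also have "B + int N * g = d + M + g" using eq by (simp add: algebra_simps)
  finally show ?thesis by (simp add: B_def)
qed

text \<open>Translation by \<open>d\<close> permutes the residues. Evenness turns the numerators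
  \<open>\<sigma> (c - g)\<close> into the values at \<open>1..g\<close>, the denominators are the
  values at \<open>0..g - 1\<close>, and all but the extreme ones cancel.\<close>

lemma prod_residues:
  fixes \<sigma> :: "int \<Rightarrow> 'a::field"
  assumes nz: "\<And>k. \<sigma> k \<noteq> 0" and ev: "\<And>k. \<sigma> (- k) = \<sigma> k" and g: "g > 0"
  shows "(\<Prod>c\<in>{0..<g}. \<sigma> ((d + c) mod g - g) / \<sigma> ((d + c) mod g)) = \<sigma> g / \<sigma> 0"
proof -
  have "bij_betw (\<lambda>c. (d + c) mod g) {0..<g} {0..<g}"
    by (rule bij_betw_byWitness[where f' = "\<lambda>c. (c - d) mod g"]) (use g in \<open>auto simp: mod_simps\<close>)
  then have "(\<Prod>c\<in>{0..<g}. \<sigma> ((d + c) mod g - g) / \<sigma> ((d + c) mod g)) =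
      (\<Prod>c\<in>{0..<g}. \<sigma> (c - g) / \<sigma> c)"
    by (rule prod.reindex_bij_betw)
  also have "\<dots> = (\<Prod>c\<in>{0..<g}. \<sigma> (c - g)) / (\<Prod>c\<in>{0..<g}. \<sigma> c)"
    by (rule prod_dividef)
  also have "(\<Prod>c\<in>{0..<g}. \<sigma> (c - g)) = (\<Prod>c\<in>{1..g}. \<sigma> c)"
    by (rule prod.reindex_bij_witness[where i = "\<lambda>c. g - c" and j = "\<lambda>c. g - c"])
       (auto, metis ev minus_diff_eq)
  also have "{1..g} = insert g {1..<g}" using g by auto
  also have "(\<Prod>c\<in>{0..<g}. \<sigma> c) = (\<Prod>c\<in>insert 0 {1..<g}. \<sigma> c)"
    using g by (intro prod.cong) auto
  finally have "(\<Prod>c\<in>{0..<g}. \<sigma> ((d + c) mod g - g) / \<sigma> ((d + c) mod g)) =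
      (\<Prod>c\<in>insert g {1..<g}. \<sigma> c) / (\<Prod>c\<in>insert 0 {1..<g}. \<sigma> c)" .
  then show ?thesis using nz by simp
qed

subsection \<open>Antisymmetric sets encoded by residues\<close>

text \<open>In \<open>coded t \<rho> D\<close> the integers \<open>\<rho> j\<close> are the numbers \<open>\<plusminus> r\<^sub>i\<close>, with the sign and the order
  chosen so that \<open>\<rho> j\<close> is congruent to \<open>j\<close> modulo \<open>2t\<close>. By antisymmetry the class of \<open>j - t\<close>
  determines the opposite class.\<close>

definition coded :: "nat \<Rightarrow> (nat \<Rightarrow> int) \<Rightarrow> int set \<Rightarrow> bool" where
  "coded t \<rho> D \<longleftrightarrow> (\<forall>j\<in>{1..t}. 2 * int t dvd \<rho> j - int j) \<and> \<rho> t > 0 \<and>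
    (\<forall>j\<in>{1..<t}. \<forall>w. 2 * int t dvd w - (int j - int t) \<longrightarrow> (w \<in> anti D \<longleftrightarrow> w \<le> \<rho> j - int t)) \<and>
    (\<forall>w. 2 * int t dvd w - int t \<longrightarrow> (w \<in> anti D \<longleftrightarrow> w \<le> - int t)) \<and>
    (\<forall>w>0. 2 * int t dvd w \<longrightarrow> (w \<in> anti D \<longleftrightarrow> w \<le> \<rho> t - int t))"

lemma dvd_less_imp_nonpos: "(g::int) dvd x \<Longrightarrow> x < g \<Longrightarrow> x \<le> 0"
  by (meson linorder_not_le zdvd_imp_le)

lemma dvd_less_imp_le_diff: "(g::int) dvd w - M \<Longrightarrow> w < M \<Longrightarrow> w \<le> M - g"
  using zdvd_imp_le[of g "M - w"] by (simp add: dvd_diff_commute)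

text \<open>Besides the self-opposite residues 0 and \<open>t\<close>, the classes come in opposite
  pairs \<open>j - t\<close> and \<open>- j - t\<close>, congruent to \<open>t + j\<close> and
  \<open>t - j\<close>.\<close>

lemma residue_cases:
  fixes w :: int
  assumes "t \<ge> 1"
  obtains "2 * int t dvd w" | "2 * int t dvd w - int t"
  | j where "j \<in> {1..<t}" "2 * int t dvd w - (int j - int t)"
  | j where "j \<in> {1..<t}" "2 * int t dvd w - (- int j - int t)"
proof -
  define c where "c = w mod (2 * int t)"
  have c: "0 \<le> c" "c < 2 * int t" using assms by (auto simp: c_def)
  have dc: "2 * int t dvd w - c" by (simp add: c_def)
  consider "c = 0" | "c = int t" | "0 < c" "c < int t" | "int t < c"
    using c by linarith
  then show thesis
  proof cases
    case 3
    have "w - (- int (nat (int t - c)) - int t) = w - c + 2 * int t" using 3 by simp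
    then have "2 * int t dvd w - (- int (nat (int t - c)) - int t)"
      using dc by (metis dvd_add_triv_right_iff)
    moreover have "nat (int t - c) \<in> {1..<t}" using 3 by auto
    ultimately show thesis using that(4) by blast
  next
    case 4
    have "w - (int (nat (c - int t)) - int t) = w - c + 2 * int t" using 4 by simp
    then have "2 * int t dvd w - (int (nat (c - int t)) - int t)"
      using dc by (metis dvd_add_triv_right_iff)
    moreover have "nat (c - int t) \<in> {1..<t}" using 4 c by auto
    ultimately show thesis using that(3) by blast
  qed (use dc that in auto)
qed

text \<open>Antisymmetry applied to \<open>- w\<close>, which lies in the class of
  \<open>j - t\<close>, gives \<open>w < t - \<rho> j\<close>. As \<open>t - \<rho> j\<close> lies
  in the class of \<open>w\<close> itself, strictness lowers the bound by a full period.\<close>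

lemma coded_neg:
  assumes cd: "coded t \<rho> D" and j: "j \<in> {1..<t}" and w: "2 * int t dvd w - (- int j - int t)"
  shows "w \<in> anti D \<longleftrightarrow> w \<le> - \<rho> j - int t"
proof -
  have rj: "2 * int t dvd \<rho> j - int j" using cd j by (auto simp: coded_def)
  have 1: "- w - (int j - int t) = 2 * int t - (w - (- int j - int t))" by simp
  have "2 * int t dvd - w - (int j - int t)" unfolding 1 using w by (rule dvd_diff[OF dvd_refl])
  then have "- w \<in> anti D \<longleftrightarrow> - w \<le> \<rho> j - int t" using cd j by (auto simp: coded_def)
  moreover have "w \<noteq> 0"
  proof
    assume "w = 0"
    then have "2 * int t dvd int j + int t" using w by (simp add: add.commute)
    then show False using j zdvd_imp_le[of "2 * int t" "int j + int t"] by auto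
  qed
  ultimately have *: "w \<in> anti D \<longleftrightarrow> w < int t - \<rho> j" by (simp add: anti_uminus) linarith
  have 2: "w - (- \<rho> j - int t) = (w - (- int j - int t)) + (\<rho> j - int j)" by simp
  have "2 * int t dvd w - (- \<rho> j - int t)" unfolding 2 using w rj by (rule dvd_add)
  from dvd_less_imp_nonpos[OF this] have "w < int t - \<rho> j \<Longrightarrow> w \<le> - \<rho> j - int t" by simp
  moreover have "t > 0" using j by auto
  ultimately show ?thesis using * by linarith
qed

text \<open>The negative half is the complement of the reflected positive half. Up to the missing
  point 0 this is the word of a rectangle as in \<open>DD1'\<close>.\<close>

lemma coded_zero:
  assumes cd: "coded t \<rho> D" and t: "t \<ge> 1" and w: "2 * int t dvd w"
  shows "w \<in> anti D \<longleftrightarrow> (0 < w \<and> w \<le> \<rho> t - int t) \<or> w \<le> - \<rho> t - int t"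
proof -
  have rt: "2 * int t dvd \<rho> t - int t" "\<rho> t > 0" using cd t by (auto simp: coded_def)
  consider "w = 0" | "w > 0" | "w < 0" by linarith
  then show ?thesis
  proof cases
    case 3
    then have "- w \<in> anti D \<longleftrightarrow> - w \<le> \<rho> t - int t" using cd w by (auto simp: coded_def)
    then have *: "w \<in> anti D \<longleftrightarrow> w < int t - \<rho> t" using 3 by (simp add: anti_uminus) linarith
    have 2: "w - (- \<rho> t - int t) = w + (\<rho> t - int t) + 2 * int t" by simp
    have "2 * int t dvd w - (- \<rho> t - int t)" unfolding 2 using w rt by (intro dvd_add) auto
    from dvd_less_imp_nonpos[OF this] show ?thesis using * 3 t by auto
  qed (use cd w rt in \<open>auto simp: coded_def\<close>)
qed

text \<open>The numbers \<open>\<rho> j - t\<close> and \<open>- \<rho> j - t\<close> are the tops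
  of their classes, hence lie in \<open>anti D\<close>, whose elements are at most \<open>d\<close>.
  For \<open>j = t\<close> only \<open>\<rho> t - t\<close> matters, and if it is not positive then
  \<open>d \<ge> 0\<close> suffices.\<close>

lemma coded_bound:
  assumes cd: "coded t \<rho> D" and t: "t \<ge> 1" and d: "d \<ge> 0" and mx: "\<And>x. x \<in> D \<Longrightarrow> x \<le> d"
    and j: "j \<in> {1..t}"
  shows "\<bar>\<rho> j\<bar> - int t \<le> d"
proof -
  have le: "x \<le> d" if "x \<in> anti D" for x
    using that mx d by (cases "x > 0") (auto simp: anti_pos)
  have rj: "2 * int t dvd \<rho> j - int j" using cd j by (auto simp: coded_def)
  show ?thesis
  proof (cases "j = t")
    case True
    then show ?thesis using le[of "\<rho> t - int t"] coded_zero[OF cd t, of "\<rho> t - int t"] rj cd d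
      by (cases "\<rho> t - int t > 0") (auto simp: coded_def)
  next
    case False
    then have j: "j \<in> {1..<t}" using j by auto
    have "\<rho> j - int t \<in> anti D" using cd j rj by (auto simp: coded_def)
    moreover have "- \<rho> j - int t \<in> anti D"
      using coded_neg[OF cd j, of "- \<rho> j - int t"] rj dvd_minus_iff[of _ "\<rho> j - int j"] by simp
    ultimately show ?thesis using le[of "\<rho> j - int t"] le[of "- \<rho> j - int t"] by auto
  qed
qed

text \<open>\<open>d\<close> lies in \<open>anti D\<close> but \<open>d + 2 * t\<close> does not, so
  \<open>d\<close> is the top of its residue class and therefore equals some
  \<open>\<rho> j - t\<close> or \<open>- \<rho> j - t\<close>. The class of \<open>t\<close> is
  excluded because it has no positive elements.\<close>

lemma coded_max:
  assumes cd: "coded t \<rho> D" and t: "t \<ge> 1" and d: "d \<in> D" "d > 0" "\<And>x. x \<in> D \<Longrightarrow> x \<le> d"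
  obtains j where "j \<in> {1..t}" "\<bar>\<rho> j\<bar> = d + int t"
proof -
  have dA: "d \<in> anti D" "d + 2 * int t \<notin> anti D" using d t by (force simp: anti_pos)+
  have rj: "2 * int t dvd \<rho> j - int j" if "j \<in> {1..t}" for j using that cd by (auto simp: coded_def)
  have eq: "d = M" if "2 * int t dvd d - M" "\<And>w. w \<in> {d, d + 2 * int t} \<Longrightarrow> w \<in> anti D \<longleftrightarrow> w \<le> M" for M
    using that dA dvd_less_imp_nonpos[of "2 * int t" "M - d"] by (auto simp: dvd_diff_commute)
  have sh: "2 * int t dvd d + 2 * int t - M" if "2 * int t dvd d - M" for M
  proof -
    have "d + 2 * int t - M = d - M + 2 * int t" by simp
    then show ?thesis using that by (metis dvd_add_triv_right_iff)
  qed
  show thesis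
  proof (rule residue_cases[OF t, of d])
    assume 1: "2 * int t dvd d"
    have "\<rho> t > 0" using cd by (auto simp: coded_def)
    moreover have "d = \<rho> t - int t"
    proof (rule eq)
      show "2 * int t dvd d - (\<rho> t - int t)" using 1 rj[of t] t by (intro dvd_diff[OF 1]) auto
      fix w assume w: "w \<in> {d, d + 2 * int t}"
      then have "w > 0" "2 * int t dvd w" using 1 d by auto
      then show "w \<in> anti D \<longleftrightarrow> w \<le> \<rho> t - int t" using cd by (auto simp: coded_def)
    qed
    ultimately show thesis using that[of t] t by auto
  next
    assume "2 * int t dvd d - int t"
    then show thesis using cd dA d by (auto simp: coded_def)
  next
    fix j assume 3: "j \<in> {1..<t}" "2 * int t dvd d - (int j - int t)"
    have "d = \<rho> j - int t"
    proof (rule eq)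
      have e: "d - (\<rho> j - int t) = d - (int j - int t) - (\<rho> j - int j)" by simp
      show "2 * int t dvd d - (\<rho> j - int t)" unfolding e by (rule dvd_diff[OF 3(2) rj]) (use 3 in auto)
      fix w assume "w \<in> {d, d + 2 * int t}"
      then show "w \<in> anti D \<longleftrightarrow> w \<le> \<rho> j - int t" using 3 cd sh[OF 3(2)] by (auto simp: coded_def)
    qed
    then show thesis using that[of j] 3 d by auto
  next
    fix j assume 4: "j \<in> {1..<t}" "2 * int t dvd d - (- int j - int t)"
    have "d = - \<rho> j - int t"
    proof (rule eq)
      have e: "d - (- \<rho> j - int t) = d - (- int j - int t) + (\<rho> j - int j)" by simp
      show "2 * int t dvd d - (- \<rho> j - int t)" unfolding e by (rule dvd_add[OF 4(2) rj]) (use 4 in auto)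
      fix w assume "w \<in> {d, d + 2 * int t}"
      then show "w \<in> anti D \<longleftrightarrow> w \<le> - \<rho> j - int t"
        using 4(2) sh[OF 4(2)] coded_neg[OF cd 4(1)] by auto
    qed
    then show thesis using that[of j] 4 d by auto
  qed
qed

lemma prod_split_residues:
  fixes F :: "int \<Rightarrow> 'a::comm_monoid_mult"
  assumes "t \<ge> 1"
  shows "(\<Prod>c\<in>{0..<2 * int t}. F c) = F 0 * F (int t) * (\<Prod>j\<in>{1..<t}. F (int t + int j) * F (int t - int j))"
proof -
  have "(\<Prod>c\<in>{0..<2 * int t}. F c) = prod F (insert 0 (insert (int t) ({int t<..<2 * int t} \<union> {0<..<int t})))"
    using assms by (intro prod.cong) auto
  also have "\<dots> = F 0 * F (int t) * (prod F {int t<..<2 * int t} * prod F {0<..<int t})"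
    using assms by (simp add: prod.union_disjoint mult.assoc)
  also have "prod F {int t<..<2 * int t} = (\<Prod>j\<in>{1..<t}. F (int t + int j))"
    by (rule prod.reindex_bij_witness[where i = "\<lambda>j. int t + int j" and j = "\<lambda>c. nat (c - int t)"]) auto
  also have "prod F {0<..<int t} = (\<Prod>j\<in>{1..<t}. F (int t - int j))"
    by (rule prod.reindex_bij_witness[where i = "\<lambda>j. int t - int j" and j = "\<lambda>c. nat (int t - c)"]) auto
  finally show ?thesis by (simp add: prod.distrib)
qed

text \<open>The class of 0 is \<open>{w \<le> \<rho> t - t} - {w \<le> 0} + {w \<le> - \<rho> t - t}\<close> as a signed multiset: this is the
  origin of the factor \<open>1 / H 0\<close>. The lower ends of the telescoping products run through all
  residues and contribute \<open>\<sigma> g / \<sigma> 0\<close>.\<close>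

lemma coded_prod:
  fixes \<sigma> :: "int \<Rightarrow> 'a::field"
  assumes nz: "\<And>k. \<sigma> k \<noteq> 0" and ev: "\<And>k. \<sigma> (- k) = \<sigma> k"
    and cd: "coded t \<rho> D" and t: "t \<ge> 1" and d: "d > 0" "\<And>x. x \<in> D \<Longrightarrow> x \<le> d"
  defines "g \<equiv> 2 * int t"
  defines "H \<equiv> \<lambda>M. \<sigma> (d + M + g) / \<sigma> (d + M)"
  shows "(\<Prod>w\<in>anti D \<inter> {- d..d}. ratio2 \<sigma> g (d + w)) =
    (\<Prod>j\<in>{1..t}. H (\<rho> j - int t) * H (- \<rho> j - int t)) * (H (- int t) / H 0) * (\<sigma> g / \<sigma> 0)"
proof -
  have g: "g > 0" using t by (simp add: g_def)
  have rj: "g dvd \<rho> j - int j" if "j \<in> {1..t}" for j using that cd by (auto simp: coded_def g_def)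
  have bd: "\<bar>\<rho> j\<bar> - int t \<le> d" if "j \<in> {1..t}" for j using coded_bound[OF cd t _ d(2) that] d by simp
  define S where "S = anti D \<inter> {- d..d}"
  define Q where "Q = (\<lambda>c. \<sigma> ((d + c) mod g - g) / \<sigma> ((d + c) mod g))"
  define E where "E = (\<lambda>c. \<Prod>w\<in>{w \<in> S. w mod g = c}. ratio2 \<sigma> g (d + w))"
  define T where "T = (\<lambda>M. \<Prod>w\<in>{w. - d \<le> w \<and> w \<le> M \<and> g dvd w - M}. ratio2 \<sigma> g (d + w))"
  have H0: "H M \<noteq> 0" for M using nz by (simp add: H_def)
  have T: "T M = H M * Q c" if "M \<ge> - d - g" "g dvd M - c" for M c
  proof -
    have "(d + c) mod g = (d + M) mod g"
      using that(2) mod_eq_dvd_iff[of "d + M" g "d + c"] by simp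
    then show ?thesis
      using prod_residue_class[of \<sigma> g d M] nz g that by (simp add: T_def H_def Q_def)
  qed
  have cls: "E c = H M * Q c"
    if "0 \<le> c" "c < g" "g dvd M - c" "M \<ge> - d - g" "M \<le> d"
      and "\<And>w. g dvd w - M \<Longrightarrow> w \<in> anti D \<longleftrightarrow> w \<le> M" for c M
  proof -
    have M: "M mod g = c" using that(1-3) mod_eq_dvd_iff[of M g c] by simp
    have "{w \<in> S. w mod g = c} = {w. - d \<le> w \<and> w \<le> M \<and> g dvd w - M}"
      using that(5,6) unfolding S_def M[symmetric] mod_eq_dvd_iff by fastforce
    then have "E c = T M" by (simp add: E_def T_def)
    then show ?thesis using T that by simp
  qed
  have "(\<Prod>w\<in>S. ratio2 \<sigma> g (d + w)) = (\<Prod>c\<in>{0..<g}. E c)"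
    unfolding E_def by (rule prod.group[symmetric]) (use g in \<open>auto simp: S_def\<close>)
  also have "\<dots> = E 0 * E (int t) * (\<Prod>j\<in>{1..<t}. E (int t + int j) * E (int t - int j))"
    unfolding g_def by (rule prod_split_residues[OF t])
  also have "E (int t) = H (- int t) * Q (int t)"
  proof (rule cls)
    fix w assume w: "g dvd w - - int t"
    have e: "w - int t = w - - int t - g" by (simp add: g_def)
    have "g dvd w - int t" unfolding e using w by (rule dvd_diff[OF _ dvd_refl])
    then show "w \<in> anti D \<longleftrightarrow> w \<le> - int t" using cd by (simp add: coded_def g_def)
  qed (use t d in \<open>auto simp: g_def\<close>)
  also have "(\<Prod>j\<in>{1..<t}. E (int t + int j) * E (int t - int j)) =
      (\<Prod>j\<in>{1..<t}. H (\<rho> j - int t) * H (- \<rho> j - int t)) * (\<Prod>j\<in>{1..<t}. Q (int t + int j) * Q (int t - int j))"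
    unfolding prod.distrib[symmetric]
  proof (rule prod.cong[OF refl])
    fix j assume j: "j \<in> {1..<t}"
    have b: "\<bar>\<rho> j\<bar> - int t \<le> d" using bd[of j] j by simp
    have r: "g dvd \<rho> j - int j" using rj j by simp
    have "E (int t + int j) = H (\<rho> j - int t) * Q (int t + int j)"
    proof (rule cls)
      have e: "\<rho> j - int t - (int t + int j) = \<rho> j - int j - g" by (simp add: g_def)
      show "g dvd \<rho> j - int t - (int t + int j)" unfolding e using r by simp
      fix w assume w: "g dvd w - (\<rho> j - int t)"
      have e: "w - (int j - int t) = w - (\<rho> j - int t) + (\<rho> j - int j)" by simp
      have "g dvd w - (int j - int t)" unfolding e using w r by (rule dvd_add)
      then show "w \<in> anti D \<longleftrightarrow> w \<le> \<rho> j - int t" using cd j by (auto simp: coded_def g_def)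
    qed (use j b in \<open>auto simp: g_def\<close>)
    moreover have "E (int t - int j) = H (- \<rho> j - int t) * Q (int t - int j)"
    proof (rule cls)
      have e: "- \<rho> j - int t - (int t - int j) = - (\<rho> j - int j) - g" by (simp add: g_def)
      show "g dvd - \<rho> j - int t - (int t - int j)"
        unfolding e using r by (metis dvd_diff dvd_minus_iff dvd_refl)
      fix w assume w: "g dvd w - (- \<rho> j - int t)"
      have e: "w - (- int j - int t) = w - (- \<rho> j - int t) - (\<rho> j - int j)" by simp
      have "g dvd w - (- int j - int t)" unfolding e using w r by (rule dvd_diff)
      then show "w \<in> anti D \<longleftrightarrow> w \<le> - \<rho> j - int t" using coded_neg[OF cd j] by (simp add: g_def)
    qed (use j b in \<open>auto simp: g_def\<close>)
    ultimately show "E (int t + int j) * E (int t - int j) = H (\<rho> j - int t) * H (- \<rho> j - int t) *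
        (Q (int t + int j) * Q (int t - int j))" by simp
  qed
  also have "E 0 = H (\<rho> t - int t) * H (- \<rho> t - int t) / H 0 * Q 0"
  proof -
    have b: "\<bar>\<rho> t\<bar> - int t \<le> d" using bd[of t] t by simp
    have r: "g dvd \<rho> t - int t" "\<rho> t > 0" using rj[of t] t cd by (auto simp: coded_def)
    have rt: "\<rho> t \<ge> int t" using dvd_less_imp_nonpos[of g "int t - \<rho> t"] r
      by (simp add: dvd_diff_commute g_def)
    have r': "g dvd - \<rho> t - int t"
    proof -
      have e: "- \<rho> t - int t = - (\<rho> t - int t) - g" by (simp add: g_def)
      show ?thesis unfolding e using r by (metis dvd_diff dvd_minus_iff dvd_refl)
    qed
    \<comment> \<open>\<open>P\<close> is the positive part of the class of 0. The full ray up to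
      \<open>\<rho> t - t\<close> gives \<open>P\<close> times the ray up to 0, while the actual
      class gives \<open>P\<close> times the ray up to \<open>- \<rho> t - t\<close>; dividing
      eliminates \<open>P\<close>.\<close>
    define P where "P = (\<Prod>w\<in>{w. 0 < w \<and> w \<le> \<rho> t - int t \<and> g dvd w}. ratio2 \<sigma> g (d + w))"
    have fin: "finite {w. a \<le> w \<and> w \<le> b \<and> R w}" "finite {w. a < w \<and> w \<le> b \<and> R w}"
      for a b :: int and R
      by (rule finite_subset[of _ "{a..b}"]; auto)+
    have dv: "g dvd w - M \<longleftrightarrow> g dvd w" if "g dvd M" for w M
      using that by (metis diff_add_cancel dvd_add dvd_diff)
    have "{w. - d \<le> w \<and> w \<le> \<rho> t - int t \<and> g dvd w} =
        {w. 0 < w \<and> w \<le> \<rho> t - int t \<and> g dvd w} \<union> {w. - d \<le> w \<and> w \<le> 0 \<and> g dvd w}"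
      using rt d by auto
    then have "T (\<rho> t - int t) = P * T 0"
      unfolding T_def P_def dv[OF r(1)] dv[OF dvd_0_right]
      by (simp only:) (rule prod.union_disjoint; use fin in auto)
    moreover have "{w \<in> S. w mod g = 0} = {w. 0 < w \<and> w \<le> \<rho> t - int t \<and> g dvd w} \<union>
        {w. - d \<le> w \<and> w \<le> - \<rho> t - int t \<and> g dvd w}"
    proof -
      have "w \<in> S \<and> w mod g = 0 \<longleftrightarrow> (0 < w \<and> w \<le> \<rho> t - int t \<and> g dvd w) \<or>
        (- d \<le> w \<and> w \<le> - \<rho> t - int t \<and> g dvd w)" for w
        using coded_zero[OF cd t, of w, folded g_def] b d rt
        by (auto simp: S_def mod_eq_0_iff_dvd)
      then show ?thesis by auto
    qed
    then have "E 0 = P * T (- \<rho> t - int t)"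
      unfolding E_def T_def P_def dv[OF r']
      by (simp only:) (rule prod.union_disjoint; use fin rt in auto)
    moreover have "T 0 = H 0 * Q 0" "T (\<rho> t - int t) = H (\<rho> t - int t) * Q 0"
      "T (- \<rho> t - int t) = H (- \<rho> t - int t) * Q 0"
      using r r' b d g by (intro T; auto simp: g_def)+
    moreover have "Q 0 \<noteq> 0" using nz by (simp add: Q_def)
    ultimately show ?thesis using H0 by (simp add: field_simps)
  qed
  finally have "(\<Prod>w\<in>S. ratio2 \<sigma> g (d + w)) =
    (H (\<rho> t - int t) * H (- \<rho> t - int t) * (\<Prod>j\<in>{1..<t}. H (\<rho> j - int t) * H (- \<rho> j - int t))) *
    (H (- int t) / H 0) * (Q 0 * Q (int t) * (\<Prod>j\<in>{1..<t}. Q (int t + int j) * Q (int t - int j)))"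
    by (simp add: mult_ac)
  also have "Q 0 * Q (int t) * (\<Prod>j\<in>{1..<t}. Q (int t + int j) * Q (int t - int j)) = (\<Prod>c\<in>{0..<g}. Q c)"
    unfolding g_def by (rule prod_split_residues[OF t, symmetric])
  also have "\<dots> = \<sigma> g / \<sigma> 0" unfolding Q_def using nz ev g by (rule prod_residues)
  also have "H (\<rho> t - int t) * H (- \<rho> t - int t) * (\<Prod>j\<in>{1..<t}. H (\<rho> j - int t) * H (- \<rho> j - int t)) =
     (\<Prod>j\<in>{1..t}. H (\<rho> j - int t) * H (- \<rho> j - int t))"
  proof -
    have "{1..t} = insert t {1..<t}" using t by auto
    then show ?thesis by simp
  qed
  finally show ?thesis by (simp add: S_def)
qed

section \<open>Vandermonde-like products over the positive roots of type B\<close>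

definition vand :: "(int \<Rightarrow> 'a::comm_monoid_mult) \<Rightarrow> int set \<Rightarrow> 'a" where
  "vand \<sigma> R = prod \<sigma> R * (\<Prod>(a, b)\<in>{(a, b). a \<in> R \<and> b \<in> R \<and> a < b}. \<sigma> (b - a) * \<sigma> (b + a))"

text \<open>By evenness, the factors pairing \<open>r\<close> with smaller and with larger elements
  take the same form.\<close>

lemma vand_insert:
  assumes ev: "\<And>k. \<sigma> (- k) = \<sigma> k" and R: "finite R" "r \<notin> R"
  shows "vand \<sigma> (insert r R) = \<sigma> r * (\<Prod>a\<in>R. \<sigma> (r - a) * \<sigma> (r + a)) * vand \<sigma> R"
proof -
  define F where "F = (\<lambda>(a, b). \<sigma> (b - a) * \<sigma> (b + a))"
  define P0 where "P0 = {(a, b). a \<in> R \<and> b \<in> R \<and> a < b}"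
  define P1 where "P1 = (\<lambda>a. (a, r)) ` {a \<in> R. a < r}"
  define P2 where "P2 = (\<lambda>b. (r, b)) ` {b \<in> R. r < b}"
  have "P0 \<subseteq> R \<times> R" by (auto simp: P0_def)
  then have fin: "finite P0" "finite P1" "finite P2"
    using R by (auto simp: P1_def P2_def intro: finite_subset)
  have "{(a, b). a \<in> insert r R \<and> b \<in> insert r R \<and> a < b} = P0 \<union> (P1 \<union> P2)"
    by (auto simp: P0_def P1_def P2_def)
  then have "prod F {(a, b). a \<in> insert r R \<and> b \<in> insert r R \<and> a < b} = prod F P0 * prod F (P1 \<union> P2)"
    using fin R by (simp only:) (rule prod.union_disjoint, auto simp: P0_def P1_def P2_def)
  also have "prod F (P1 \<union> P2) = prod F P1 * prod F P2"
    using fin R by (intro prod.union_disjoint) (auto simp: P1_def P2_def)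
  also have "prod F P1 = (\<Prod>a\<in>{a \<in> R. a < r}. \<sigma> (r - a) * \<sigma> (r + a))"
    unfolding P1_def by (subst prod.reindex) (auto simp: inj_on_def F_def)
  also have "prod F P2 = (\<Prod>a\<in>{a \<in> R. r < a}. \<sigma> (r - a) * \<sigma> (r + a))"
    unfolding P2_def
    by (subst prod.reindex) (auto simp: inj_on_def F_def add.commute intro!: prod.cong, metis ev minus_diff_eq)
  also have "(\<Prod>a\<in>{a \<in> R. a < r}. \<sigma> (r - a) * \<sigma> (r + a)) * (\<Prod>a\<in>{a \<in> R. r < a}. \<sigma> (r - a) * \<sigma> (r + a)) =
     (\<Prod>a\<in>{a \<in> R. a < r} \<union> {a \<in> R. r < a}. \<sigma> (r - a) * \<sigma> (r + a))"
    using R by (intro prod.union_disjoint[symmetric]) auto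
  also have "{a \<in> R. a < r} \<union> {a \<in> R. r < a} = R"
    using R(2) by (auto, metis linorder_neqE)
  finally show ?thesis using R by (simp add: vand_def F_def P0_def mult_ac)
qed

text \<open>Equal absolute values make \<open>i\<close> congruent to \<open>k\<close> or to
  \<open>- k\<close> modulo \<open>2 * t\<close>; within \<open>1..t\<close> the second case forces
  \<open>i = k = t\<close>.\<close>

lemma inj_on_abs_coded:
  assumes "\<And>j. j \<in> {1..t} \<Longrightarrow> 2 * int t dvd \<rho> j - int j"
  shows "inj_on (\<lambda>j. \<bar>\<rho> j\<bar>) {1..t}"
proof (rule inj_onI)
  fix i k assume ik: "i \<in> {1..t}" "k \<in> {1..t}" and eq: "\<bar>\<rho> i\<bar> = \<bar>\<rho> k\<bar>"
  have d: "2 * int t dvd \<rho> i - int i" "2 * int t dvd \<rho> k - int k" using assms ik by auto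
  consider "\<rho> i = \<rho> k" | "\<rho> i = - \<rho> k" using eq by linarith
  then show "i = k"
  proof cases
    case 1
    have e: "int i - int k = (\<rho> k - int k) - (\<rho> i - int i)" using 1 by simp
    have "2 * int t dvd int i - int k" unfolding e by (rule dvd_diff[OF d(2,1)])
    then show ?thesis using ik dvd_imp_le_int[of "int i - int k" "2 * int t"] by (cases "i = k") auto
  next
    case 2
    have e: "- (int i + int k) = (\<rho> i - int i) + (\<rho> k - int k)" using 2 by simp
    have "2 * int t dvd - (int i + int k)" unfolding e by (rule dvd_add[OF d])
    then have "2 * int t dvd int i + int k" by (simp only: dvd_minus_iff)
    then show ?thesis using ik zdvd_imp_le[of "2 * int t" "int i + int k"] by auto
  qed
qed

lemma residue_unique:
  assumes ij: "i \<le> t" "j \<in> {1..t}" and s: "s \<in> {1, - 1}"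
    and dv: "2 * int t dvd (int i - int t) - s * (int j - int t)"
  shows "i = j \<and> (s = 1 \<or> j = t)"
proof (cases "s = 1")
  case True
  then show ?thesis using assms dvd_imp_le_int[of "int i - int j" "2 * int t"] by (cases "i = j") auto
next
  case False
  then have "s = - 1" using s by simp
  then have "int i + int j = 2 * int t"
    using assms dvd_imp_le_int[of "int i - int t - s * (int j - int t)" "2 * int t"]
    by (cases "int i + int j = 2 * int t") auto
  then show ?thesis using ij by auto
qed

text \<open>The class of \<open>d\<close> loses its top element and the opposite class gains
  \<open>- d\<close>. Both changes amount to moving \<open>\<rho> j0\<close> by one period against
  its sign; all other classes stay as they are.\<close>

lemma coded_remove_max:
  assumes cd: "coded t \<rho> D" and t: "t \<ge> 1" and d: "d \<in> D" "d > 0" "\<And>x. x \<in> D \<Longrightarrow> x \<le> d"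
    and j0: "j0 \<in> {1..t}" "\<bar>\<rho> j0\<bar> = d + int t"
  shows "coded t (\<rho>(j0 := \<rho> j0 - sgn (\<rho> j0) * (2 * int t))) (D - {d})"
proof -
  define s where "s = sgn (\<rho> j0)"
  define \<rho>' where "\<rho>' = \<rho>(j0 := \<rho> j0 - s * (2 * int t))"
  have s: "s \<in> {1, - 1}" "\<rho> j0 = s * (d + int t)" using j0 d by (auto simp: s_def sgn_if)
  have rj: "2 * int t dvd \<rho> j - int j" if "j \<in> {1..t}" for j using that cd by (auto simp: coded_def)
  have d0: "2 * int t dvd d - s * (int j0 - int t)"
  proof -
    have "d - s * (int j0 - int t) = s * (\<rho> j0 - int j0) + (s - 1) * int t"
      using s by (auto simp: algebra_simps)
    moreover have "2 * int t dvd (s - 1) * int t" using s(1) by auto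
    ultimately show ?thesis using rj[OF j0(1)] by simp
  qed
  have A: "w \<in> anti (D - {d}) \<longleftrightarrow> (w \<in> anti D \<and> w \<noteq> d) \<or> w = - d" for w
    using d by (auto simp: anti_def)
  \<comment> \<open>Only the two classes belonging to \<open>j0\<close> contain \<open>d\<close> or
    \<open>- d\<close>. The sign \<open>s\<close> decides which of the two lies in the class of
    \<open>j0 - t\<close>, unless that class is its own opposite.\<close>
  have pm: "i = j0 \<and> (w = s * d \<or> i = t)"
    if "i \<le> t" "w \<in> {d, - d}" "2 * int t dvd w - (int i - int t)" for i w
  proof -
    define e where "e = (if w = d then 1 else - 1 :: int)"
    have e: "e \<in> {1, - 1}" "w = e * d" using that by (auto simp: e_def)
    have q: "(int i - int t) - (e * s) * (int j0 - int t) =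
      e * (d - s * (int j0 - int t)) - (w - (int i - int t))" using e by (simp add: algebra_simps)
    have "2 * int t dvd (int i - int t) - (e * s) * (int j0 - int t)"
      unfolding q by (rule dvd_diff[OF dvd_mult[OF d0] that(3)])
    then have "i = j0 \<and> (e * s = 1 \<or> j0 = t)"
      using residue_unique[of i t j0 "e * s"] that(1) j0 e s by auto
    then show ?thesis using e s by auto
  qed
  have "2 * int t dvd \<rho>' j - int j" if "j \<in> {1..t}" for j
  proof (cases "j = j0")
    case True
    have q: "\<rho>' j - int j = \<rho> j - int j - s * (2 * int t)" using True by (simp add: \<rho>'_def)
    show ?thesis unfolding q by (rule dvd_diff[OF rj[OF that]]) auto
  qed (use rj that in \<open>auto simp: \<rho>'_def\<close>)
  moreover have "\<rho>' t > 0 \<and> (j0 = t \<longrightarrow> s = 1)"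
  proof (cases "j0 = t")
    case True
    then have s1: "s = 1" using cd by (auto simp: s_def coded_def)
    \<comment> \<open>Here \<open>d\<close> is a positive multiple of \<open>2 * t\<close>, so
      \<open>\<rho>' t = d - t\<close> stays positive.\<close>
    have "2 * int t \<le> d" using d0 d True by (intro zdvd_imp_le) auto
    then show ?thesis using True s s1 t by (simp add: \<rho>'_def)
  qed (use cd in \<open>auto simp: \<rho>'_def coded_def\<close>)
  moreover have "w \<in> anti (D - {d}) \<longleftrightarrow> w \<le> \<rho>' j - int t"
    if j: "j \<in> {1..<t}" and w: "2 * int t dvd w - (int j - int t)" for j w
  proof -
    have old: "w \<in> anti D \<longleftrightarrow> w \<le> \<rho> j - int t" using cd j w by (auto simp: coded_def)
    show ?thesis
    proof (cases "j = j0")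
      case False
      then have "w \<noteq> d" "w \<noteq> - d" using pm[of j w] w j by auto
      then show ?thesis using False old A by (simp add: \<rho>'_def)
    next
      case True
      have m: "2 * int t dvd w - (\<rho> j - int t)"
      proof -
        have q: "w - (\<rho> j - int t) = w - (int j - int t) - (\<rho> j - int j)" by simp
        show ?thesis unfolding q by (rule dvd_diff[OF w rj]) (use j in auto)
      qed
      then have lt: "w < \<rho> j - int t \<Longrightarrow> w \<le> \<rho> j - int t - 2 * int t"
        by (rule dvd_less_imp_le_diff)
      \<comment> \<open>For \<open>s = 1\<close> this class loses its top element \<open>d\<close>;
        for \<open>s = - 1\<close> it gains \<open>- d\<close> as its new top.\<close>
      consider "s = 1" | "s = - 1" using s by auto
      then show ?thesis
      proof cases
        case 1
        then have "w \<noteq> - d" using pm[of j w] w j d by auto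
        moreover have e: "\<rho> j - int t = d" "\<rho>' j - int t = d - 2 * int t"
          using s 1 True by (simp_all add: \<rho>'_def)
        ultimately show ?thesis unfolding A old e using lt[unfolded e] t by auto
      next
        case 2
        then have "w \<noteq> d" using pm[of j w] w j d by auto
        moreover have "w \<le> - d \<Longrightarrow> w \<noteq> - d \<Longrightarrow> w \<le> - d - 2 * int t"
          using dvd_less_imp_nonpos[OF m] 2 s True by simp
        moreover have e: "\<rho> j - int t = - d - 2 * int t" "\<rho>' j - int t = - d"
          using s 2 True by (simp_all add: \<rho>'_def)
        ultimately show ?thesis unfolding A old e using t by auto
      qed
    qed
  qed
  moreover have "w \<in> anti (D - {d}) \<longleftrightarrow> w \<le> - int t" if w: "2 * int t dvd w - int t" for w
  proof -
    have q: "w - (int 0 - int t) = w - int t + 2 * int t" by simp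
    have "2 * int t dvd w - (int 0 - int t)" unfolding q using w by (rule dvd_add) auto
    then have "w \<noteq> d" "w \<noteq> - d" using pm[of 0 w] j0 by auto
    then show ?thesis using A cd w by (auto simp: coded_def)
  qed
  moreover have "w \<in> anti (D - {d}) \<longleftrightarrow> w \<le> \<rho>' t - int t" if w: "w > 0" "2 * int t dvd w" for w
  proof (cases "j0 = t")
    case False
    then have "w \<noteq> d" "w \<noteq> - d" using pm[of t w] w by auto
    then show ?thesis using A cd w False by (auto simp: coded_def \<rho>'_def)
  next
    case True
    then have r: "\<rho> t - int t = d" using s cd d by (auto simp: coded_def)
    have "2 * int t dvd d" using d0 True by simp
    then have "2 * int t dvd w - d" using w by (intro dvd_diff)
    then have "w < d \<Longrightarrow> w \<le> d - 2 * int t"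
      by (rule dvd_less_imp_le_diff)
    moreover have "w \<in> anti D \<longleftrightarrow> w \<le> d" using cd w r by (auto simp: coded_def)
    moreover have "\<rho>' t - int t = d - 2 * int t"
      using True s r cd by (auto simp: \<rho>'_def s_def coded_def)
    ultimately show ?thesis using A w d t by auto
  qed
  ultimately show ?thesis by (auto simp: coded_def \<rho>'_def s_def)
qed

text \<open>Without positive elements the bound is \<open>\<bar>\<rho> j\<bar> \<le> t\<close>. The
  congruence then leaves only \<open>j\<close>, or \<open>- t\<close> for \<open>j = t\<close>,
  which \<open>\<rho> t > 0\<close> rules out.\<close>

lemma coded_empty:
  assumes cd: "coded t \<rho> {}" and j: "j \<in> {1..t}"
  shows "\<rho> j = int j"
proof -
  have b: "\<bar>\<rho> j\<bar> \<le> int t" using coded_bound[OF cd _ _ _ j, of 0] j by auto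
  have dv: "2 * int t dvd \<rho> j - int j" using cd j by (auto simp: coded_def)
  show ?thesis
  proof (cases "\<rho> j - int j = 0")
    case False
    then have "2 * int t \<le> \<bar>\<rho> j - int j\<bar>" using dvd_imp_le_int[OF _ dv] by simp
    then have "\<rho> j = - int t" "j = t" using b j by auto
    then show ?thesis using cd by (auto simp: coded_def)
  qed simp
qed

text \<open>Induction on the number of positive beta numbers. With \<open>r = d + t\<close> and
  \<open>g = 2 * t\<close>, removing the largest \<open>d\<close> costs \<open>2 * d\<close> boxes,
  matching \<open>r^2 - (r - g)^2 = g * (2 * d)\<close>. The empty set has
  \<open>\<rho> j = j\<close>, which explains the subtracted squares and the normalising product
  over \<open>{1..int t}\<close>.\<close>

lemma coded_pairs:
  fixes \<sigma> :: "int \<Rightarrow> 'a::field"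
  assumes nz: "\<And>k. \<sigma> k \<noteq> 0" and ev: "\<And>k. \<sigma> (- k) = \<sigma> k" and t: "t \<ge> 1"
    and D: "finite D" "\<And>x. x \<in> D \<Longrightarrow> x > 0" and cd: "coded t \<rho> D"
  shows "2 * int t * int (card (pairs D)) = (\<Sum>j\<in>{1..t}. (\<rho> j)\<^sup>2) - (\<Sum>j\<in>{1..t}. (int j)\<^sup>2) \<and>
    pair_prod \<sigma> (2 * int t) D * vand \<sigma> {1..int t} = vand \<sigma> ((\<lambda>j. \<bar>\<rho> j\<bar>) ` {1..t})"
  using D cd
proof (induction "card D" arbitrary: D \<rho>)
  case 0
  then have D: "D = {}" by simp
  have p: "pairs {} = {}" by (auto simp: pairs_def anti_def)
  have r: "\<rho> j = int j" if "j \<in> {1..t}" for j using coded_empty 0 D that by simp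
  have "(\<lambda>j. \<bar>\<rho> j\<bar>) ` {1..t} = int ` {1..t}" using r by (intro image_cong) auto
  also have "\<dots> = {1..int t}" using image_int_atLeastAtMost by force
  finally show ?case using r by (simp add: D p pair_prod_def)
next
  case (Suc n)
  define g where "g = 2 * int t"
  define d where "d = Max D"
  have D: "finite D" "\<And>x. x \<in> D \<Longrightarrow> x > 0" using Suc by auto
  have "D \<noteq> {}" using Suc by auto
  then have d: "d \<in> D" "d > 0" "\<And>x. x \<in> D \<Longrightarrow> x \<le> d" using D by (auto simp: d_def)
  obtain j0 where j0: "j0 \<in> {1..t}" "\<bar>\<rho> j0\<bar> = d + int t"
    using coded_max[OF \<open>coded t \<rho> D\<close> t d] by blast
  define s where "s = sgn (\<rho> j0)"
  define \<rho>' where "\<rho>' = \<rho>(j0 := \<rho> j0 - s * g)"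
  define r where "r = d + int t"
  have s: "s \<in> {1, - 1}" "\<rho> j0 = s * r" using j0 d by (auto simp: s_def sgn_if r_def)
  have cd': "coded t \<rho>' (D - {d})"
    using coded_remove_max[OF \<open>coded t \<rho> D\<close> t d j0] by (simp add: \<rho>'_def s_def g_def)
  have "n = card (D - {d})" using Suc.hyps(2) d D by simp
  from Suc.hyps(1)[OF this _ _ cd'] have
    IH: "g * int (card (pairs (D - {d}))) = (\<Sum>j\<in>{1..t}. (\<rho>' j)\<^sup>2) - (\<Sum>j\<in>{1..t}. (int j)\<^sup>2)"
      "pair_prod \<sigma> g (D - {d}) * vand \<sigma> {1..int t} = vand \<sigma> ((\<lambda>j. \<bar>\<rho>' j\<bar>) ` {1..t})"
    using D by (auto simp: g_def)
  have split: "{1..t} = insert j0 ({1..t} - {j0})" using j0 by auto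
  have sq: "(\<Sum>j\<in>{1..t}. (\<rho> j)\<^sup>2) = (\<Sum>j\<in>{1..t}. (\<rho>' j)\<^sup>2) + g * (2 * d)"
  proof -
    have "(\<Sum>j\<in>{1..t}. (\<rho> j)\<^sup>2) = (\<rho> j0)\<^sup>2 + (\<Sum>j\<in>{1..t} - {j0}. (\<rho> j)\<^sup>2)"
      using j0 by (intro sum.remove) auto
    moreover have "(\<Sum>j\<in>{1..t}. (\<rho>' j)\<^sup>2) = (\<rho>' j0)\<^sup>2 + (\<Sum>j\<in>{1..t} - {j0}. (\<rho>' j)\<^sup>2)"
      using j0 by (intro sum.remove) auto
    moreover have "(\<Sum>j\<in>{1..t} - {j0}. (\<rho>' j)\<^sup>2) = (\<Sum>j\<in>{1..t} - {j0}. (\<rho> j)\<^sup>2)"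
      by (intro sum.cong) (auto simp: \<rho>'_def)
    moreover have "(\<rho> j0)\<^sup>2 = (\<rho>' j0)\<^sup>2 + g * (2 * d)"
      using s by (auto simp: \<rho>'_def g_def r_def power2_eq_square algebra_simps)
    ultimately show ?thesis by simp
  qed
  define R0 where "R0 = (\<lambda>j. \<bar>\<rho> j\<bar>) ` ({1..t} - {j0})"
  have finR0: "finite R0" by (simp add: R0_def)
  \<comment> \<open>The factors involving the index \<open>j0\<close> are split off for
    \<open>\<rho>\<close> (with \<open>q = r\<close>) and for \<open>\<rho>'\<close> (with
    \<open>q = r - g\<close>) at once. The number \<open>q\<close> may be negative; evenness absorbs
    its sign and the signs of the \<open>\<rho> j\<close>.\<close>
  have vd: "vand \<sigma> ((\<lambda>j. \<bar>\<pi> j\<bar>) ` {1..t}) =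
      \<sigma> q * (\<Prod>j\<in>{1..t} - {j0}. \<sigma> (q - \<rho> j) * \<sigma> (q + \<rho> j)) * vand \<sigma> R0"
    if cdp: "coded t \<pi> C" and \<pi>: "\<And>j. j \<noteq> j0 \<Longrightarrow> \<pi> j = \<rho> j" and q: "\<pi> j0 = s * q" for \<pi> C q
  proof -
    have inj: "inj_on (\<lambda>j. \<bar>\<pi> j\<bar>) {1..t}"
      using cdp by (intro inj_on_abs_coded) (auto simp: coded_def)
    have R0': "R0 = (\<lambda>j. \<bar>\<pi> j\<bar>) ` ({1..t} - {j0})"
      unfolding R0_def by (rule image_cong) (simp_all add: \<pi>)
    have im: "(\<lambda>j. \<bar>\<pi> j\<bar>) ` {1..t} = insert \<bar>\<pi> j0\<bar> R0"
      unfolding R0' by (subst split) (rule image_insert)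
    have "\<bar>\<pi> j0\<bar> \<notin> R0"
      unfolding R0' using inj_on_image_mem_iff[OF inj j0(1)] by blast
    then have "vand \<sigma> (insert \<bar>\<pi> j0\<bar> R0) =
        \<sigma> \<bar>\<pi> j0\<bar> * (\<Prod>a\<in>R0. \<sigma> (\<bar>\<pi> j0\<bar> - a) * \<sigma> (\<bar>\<pi> j0\<bar> + a)) * vand \<sigma> R0"
      using ev finR0 by (intro vand_insert)
    also have "(\<Prod>a\<in>R0. \<sigma> (\<bar>\<pi> j0\<bar> - a) * \<sigma> (\<bar>\<pi> j0\<bar> + a)) =
        (\<Prod>j\<in>{1..t} - {j0}. \<sigma> (\<bar>\<pi> j0\<bar> - \<bar>\<pi> j\<bar>) * \<sigma> (\<bar>\<pi> j0\<bar> + \<bar>\<pi> j\<bar>))"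
      unfolding R0' using inj by (subst prod.reindex) (auto intro: inj_on_subset)
    also have "\<dots> = (\<Prod>j\<in>{1..t} - {j0}. \<sigma> (q - \<rho> j) * \<sigma> (q + \<rho> j))"
    proof (rule prod.cong[OF refl])
      fix j assume "j \<in> {1..t} - {j0}"
      then have "\<pi> j = \<rho> j" using \<pi> by simp
      moreover have "\<sigma> (\<bar>x\<bar> - \<bar>y\<bar>) * \<sigma> (\<bar>x\<bar> + \<bar>y\<bar>) = \<sigma> (x - y) * \<sigma> (x + y)" for x y
        using ev[of "x - y"] ev[of "x + y"] by (auto simp: abs_if mult.commute add.commute)
      moreover have "\<sigma> (s * q - y) * \<sigma> (s * q + y) = \<sigma> (q - y) * \<sigma> (q + y)" for y
        using ev[of "q - y"] ev[of "q + y"] s by (auto simp: mult.commute add.commute)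
      ultimately show "\<sigma> (\<bar>\<pi> j0\<bar> - \<bar>\<pi> j\<bar>) * \<sigma> (\<bar>\<pi> j0\<bar> + \<bar>\<pi> j\<bar>) = \<sigma> (q - \<rho> j) * \<sigma> (q + \<rho> j)"
        by (simp add: q)
    qed
    also have "\<sigma> \<bar>\<pi> j0\<bar> = \<sigma> q" using s ev[of q] by (auto simp: q abs_if)
    finally show ?thesis unfolding im .
  qed
  have v1: "vand \<sigma> ((\<lambda>j. \<bar>\<rho> j\<bar>) ` {1..t}) =
      \<sigma> r * (\<Prod>j\<in>{1..t} - {j0}. \<sigma> (r - \<rho> j) * \<sigma> (r + \<rho> j)) * vand \<sigma> R0"
    using \<open>coded t \<rho> D\<close> s by (intro vd) auto
  have v2: "vand \<sigma> ((\<lambda>j. \<bar>\<rho>' j\<bar>) ` {1..t}) =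
      \<sigma> (r - g) * (\<Prod>j\<in>{1..t} - {j0}. \<sigma> (r - g - \<rho> j) * \<sigma> (r - g + \<rho> j)) * vand \<sigma> R0"
    using s by (intro vd[OF cd']) (auto simp: \<rho>'_def algebra_simps)
  define H where "H = (\<lambda>M. \<sigma> (d + M + g) / \<sigma> (d + M))"
  have "(\<Prod>w\<in>anti D \<inter> {- d..d}. ratio2 \<sigma> g (d + w)) =
    (\<Prod>j\<in>{1..t}. H (\<rho> j - int t) * H (- \<rho> j - int t)) * (H (- int t) / H 0) * (\<sigma> g / \<sigma> 0)"
    using coded_prod[of \<sigma>, OF nz ev \<open>coded t \<rho> D\<close> t d(2,3)] by (simp add: H_def g_def)
  also have "(\<Prod>j\<in>{1..t}. H (\<rho> j - int t) * H (- \<rho> j - int t)) = H (\<rho> j0 - int t) * H (- \<rho> j0 - int t) *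
      (\<Prod>j\<in>{1..t} - {j0}. H (\<rho> j - int t) * H (- \<rho> j - int t))"
    using j0 by (intro prod.remove) auto
  \<comment> \<open>For either sign of \<open>\<rho> j0\<close> the two arguments are
    \<open>d\<close> and \<open>- d - g\<close>. The resulting factors cancel the lower ends
    \<open>\<sigma> g / \<sigma> 0\<close> and the correction for the corner; \<open>H 0\<close>
    cancels the correction for \<open>(0, d)\<close>.\<close>
  also have "H (\<rho> j0 - int t) * H (- \<rho> j0 - int t) = \<sigma> (2 * d + g) / \<sigma> (2 * d) * (\<sigma> 0 / \<sigma> g)"
  proof -
    have "H d * H (- d - g) = \<sigma> (2 * d + g) / \<sigma> (2 * d) * (\<sigma> 0 / \<sigma> g)"
      using ev[of g] by (simp add: H_def)
    moreover have "- d - g = - r - int t" by (simp add: g_def r_def)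
    ultimately show ?thesis using s by (auto simp: r_def mult.commute)
  qed
  also have "(\<Prod>j\<in>{1..t} - {j0}. H (\<rho> j - int t) * H (- \<rho> j - int t)) =
      (\<Prod>j\<in>{1..t} - {j0}. \<sigma> (r - \<rho> j) * \<sigma> (r + \<rho> j)) /
      (\<Prod>j\<in>{1..t} - {j0}. \<sigma> (r - g - \<rho> j) * \<sigma> (r - g + \<rho> j))"
    unfolding prod_dividef[symmetric]
    by (intro prod.cong) (auto simp: H_def r_def g_def algebra_simps)
  also have "H (- int t) = \<sigma> r / \<sigma> (r - g)" by (simp add: H_def r_def g_def algebra_simps)
  finally have S: "(\<Prod>w\<in>anti D \<inter> {- d..d}. ratio2 \<sigma> g (d + w)) *
      (\<sigma> (2 * d) * \<sigma> (d + g) / (\<sigma> (2 * d + g) * \<sigma> d)) =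
      (\<Prod>j\<in>{1..t} - {j0}. \<sigma> (r - \<rho> j) * \<sigma> (r + \<rho> j)) /
      (\<Prod>j\<in>{1..t} - {j0}. \<sigma> (r - g - \<rho> j) * \<sigma> (r - g + \<rho> j)) * (\<sigma> r / \<sigma> (r - g))"
    using nz by (simp add: H_def)
  define K where "K = (\<Prod>j\<in>{1..t} - {j0}. \<sigma> (r - \<rho> j) * \<sigma> (r + \<rho> j)) /
      (\<Prod>j\<in>{1..t} - {j0}. \<sigma> (r - g - \<rho> j) * \<sigma> (r - g + \<rho> j)) * (\<sigma> r / \<sigma> (r - g))"
  have "pair_prod \<sigma> g D = pair_prod \<sigma> g (D - {d}) *
      ((\<Prod>w\<in>anti D \<inter> {- d..d}. ratio2 \<sigma> g (d + w)) *
      (\<sigma> (2 * d) * \<sigma> (d + g) / (\<sigma> (2 * d + g) * \<sigma> d)))"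
    unfolding mult.assoc[symmetric] using nz D(1) d by (rule pair_prod_remove_max)
  then have "pair_prod \<sigma> g D = pair_prod \<sigma> g (D - {d}) * K" by (simp only: S K_def)
  then have "pair_prod \<sigma> g D * vand \<sigma> {1..int t} = vand \<sigma> ((\<lambda>j. \<bar>\<rho>' j\<bar>) ` {1..t}) * K"
    by (simp only: IH(2)[symmetric] mult_ac)
  also have "\<dots> = vand \<sigma> ((\<lambda>j. \<bar>\<rho> j\<bar>) ` {1..t})"
  proof -
    have "(\<Prod>j\<in>{1..t} - {j0}. \<sigma> (r - g - \<rho> j) * \<sigma> (r - g + \<rho> j)) \<noteq> 0"
      using nz by (simp add: prod_zero_iff)
    then show ?thesis unfolding v1 v2 K_def using nz[of "r - g"] by (simp add: field_simps)
  qed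
  finally have "pair_prod \<sigma> g D * vand \<sigma> {1..int t} = vand \<sigma> ((\<lambda>j. \<bar>\<rho> j\<bar>) ` {1..t})" .
  moreover have "g * int (card (pairs D)) = (\<Sum>j\<in>{1..t}. (\<rho> j)\<^sup>2) - (\<Sum>j\<in>{1..t}. (int j)\<^sup>2)"
    using IH(1) sq card_pairs_remove_max[OF D(1) d] by (simp add: distrib_left)
  ultimately show ?case by (simp add: g_def)
qed

subsection \<open>Beta sets of doubled distinct partitions\<close>

lemma part_antimono:
  assumes "is_partition lam" "1 \<le> i" "i \<le> k"
  shows "part lam k \<le> part lam i"
proof (cases "i = k \<or> k > length lam")
  case False
  then have "lam ! (i - 1) \<ge> lam ! (k - 1)"
    using assms by (auto simp: is_partition_def sorted_wrt_iff_nth_less)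
  then show ?thesis using False assms by (simp add: part_def)
qed (auto simp: part_def)

lemma down_closed_eq_atLeastAtMost_card:
  fixes S :: "nat set"
  assumes "finite S" "0 \<notin> S" and dc: "\<And>i k. k \<in> S \<Longrightarrow> 1 \<le> i \<Longrightarrow> i \<le> k \<Longrightarrow> i \<in> S"
  shows "S = {1..card S}"
proof (cases "S = {}")
  case False
  have "x \<in> S \<longleftrightarrow> x \<in> {1..Max S}" for x
  proof
    assume "x \<in> S"
    then show "x \<in> {1..Max S}" using assms(1,2) by (cases x) auto
  next
    assume "x \<in> {1..Max S}"
    then show "x \<in> S" using dc[OF Max_in[OF assms(1) False]] by auto
  qed
  then have "S = {1..Max S}" by blast
  then show ?thesis by (metis card_atLeastAtMost diff_Suc_1)
qed simp

lemma part_conjugate: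
  assumes p: "is_partition lam" and j: "1 \<le> j"
  shows "part (conjugate lam) j = card {i. 1 \<le> i \<and> j \<le> part lam i}"
proof (cases "j \<le> part lam 1")
  case True
  then have "conjugate lam ! (j - 1) = card {i. 1 \<le> i \<and> j \<le> part lam i}"
    "length (conjugate lam) = part lam 1"
    using j nth_upt[of 1 "j - 1" "Suc (part lam 1)"] by (simp_all add: conjugate_def del: upt_Suc)
  then show ?thesis using True j by (simp add: part_def[of "conjugate lam"])
next
  case False
  then have e: "{i. 1 \<le> i \<and> j \<le> part lam i} = {}"
    using part_antimono[OF p, of 1] le_trans by blast
  have "length (conjugate lam) = part lam 1" by (simp add: conjugate_def)
  then have "part (conjugate lam) j = 0" using False by (simp add: part_def[of "conjugate lam"])
  then show ?thesis unfolding e by simp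
qed

lemma le_part_conjugate_iff:
  assumes p: "is_partition lam" and ij: "1 \<le> i" "1 \<le> j"
  shows "i \<le> part (conjugate lam) j \<longleftrightarrow> j \<le> part lam i"
proof -
  define S where "S = {i. 1 \<le> i \<and> j \<le> part lam i}"
  have "S \<subseteq> {..length lam}" using ij by (auto simp: S_def part_def split: if_splits)
  then have "finite S" by (rule finite_subset) auto
  then have "S = {1..card S}"
  proof (rule down_closed_eq_atLeastAtMost_card)
    fix i k assume "k \<in> S" "1 \<le> i" "i \<le> k"
    then show "i \<in> S" using part_antimono[OF p, of i k] by (simp add: S_def)
  qed (simp add: S_def)
  then have "i \<in> S \<longleftrightarrow> i \<in> {1..card S}" by (rule arg_cong)
  then show ?thesis using ij part_conjugate[OF p ij(2)] by (simp add: S_def)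
qed

text \<open>Taking \<open>b\<close> to be the parts of a preimage in \<open>DD\<close> gives the
  column lengths of \<open>lam\<close> without conjugating twice; \<open>i \<le> b i\<close> places
  \<open>i\<close> within the Durfee square of that preimage.\<close>

lemma DD'_parts:
  assumes "lam \<in> DD'"
  obtains b where "\<And>i j. 1 \<le> i \<Longrightarrow> 1 \<le> j \<Longrightarrow> j \<le> part lam i \<longleftrightarrow> i \<le> b j"
    and "\<And>i. 1 \<le> i \<Longrightarrow> i \<le> b i \<Longrightarrow> b i = part lam i + 1"
proof -
  obtain mu where mu: "mu \<in> DD" "lam = conjugate mu" using assms by (auto simp: DD'_def)
  then have p: "is_partition mu" by (simp add: DD_def)
  show thesis
  proof (rule that[of "part mu"])
    fix i assume i: "1 \<le> i" "i \<le> part mu i"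
    have "{s. 1 \<le> s \<and> s \<le> part mu s} \<subseteq> {..length mu}" by (auto simp: part_def split: if_splits)
    then have "finite (insert 0 {s. 1 \<le> s \<and> s \<le> part mu s})" using finite_subset by auto
    then have "i \<le> durfee mu" unfolding durfee_def using i by (intro Max_ge) auto
    then show "part mu i = part lam i + 1" using mu i by (auto simp: DD_def)
  qed (use le_part_conjugate_iff[OF p] mu in auto)
qed

definition pos_beta :: "nat list \<Rightarrow> int set" where
  "pos_beta lam = {y. y > 0 \<and> word lam (y - 1) = 0}"

lemma word_eq_0_iff: "word lam k = 0 \<longleftrightarrow> (\<exists>i\<ge>1. k = int (part lam i) - int i)"
  by (simp add: word_def)

section \<open>Rows, columns and boxes of a partition in \<open>DD'\<close>\<close>

context
  fixes lam :: "nat list" and b :: "nat \<Rightarrow> nat"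
  assumes galois: "\<And>i j. 1 \<le> i \<Longrightarrow> 1 \<le> j \<Longrightarrow> j \<le> part lam i \<longleftrightarrow> i \<le> b j"
    and diag: "\<And>i. 1 \<le> i \<Longrightarrow> i \<le> b i \<Longrightarrow> b i = part lam i + 1"
begin

lemma row_antimono: "1 \<le> i \<Longrightarrow> i \<le> k \<Longrightarrow> part lam k \<le> part lam i"
  using galois[of k "part lam k"] galois[of i "part lam k"] by (cases "part lam k = 0") auto

lemma col_antimono: "1 \<le> i \<Longrightarrow> i \<le> k \<Longrightarrow> b k \<le> b i"
  using galois[of "b k" k] galois[of "b k" i] by (cases "b k = 0") auto

text \<open>If the box \<open>(i, j)\<close> is present, arm and leg are nonnegative and the sum is
  at least 1. If it is absent, \<open>part lam i < j\<close> and \<open>b j < i\<close>, and the sum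
  is at most \<open>- 1\<close>.\<close>

lemma row_col_sum:
  assumes "1 \<le> i" "1 \<le> j"
  shows "j \<le> part lam i \<longleftrightarrow> int (part lam i) - int i + 1 + (int (b j) - int j) > 0"
    and "int (part lam i) - int i + 1 + (int (b j) - int j) \<noteq> 0"
  using galois[OF assms] assms by linarith+

text \<open>No \<open>j - b j\<close> is a row number, because the sum in \<open>row_col_sum\<close>
  never vanishes. Conversely, a missed \<open>y\<close> lies just above the number of a first row
  \<open>i\<close>, and the column ending directly above that row attains it.\<close>

lemma word_complement:
  "word lam (y - 1) = 0 \<longleftrightarrow> (\<forall>j\<ge>1. y \<noteq> int j - int (b j))"
proof
  assume "word lam (y - 1) = 0"
  then obtain i where i: "i \<ge> 1" "y = int (part lam i) - int i + 1" by (auto simp: word_eq_0_iff)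
  then show "\<forall>j\<ge>1. y \<noteq> int j - int (b j)" using row_col_sum(2)[OF i(1)] by fastforce
next
  assume *: "\<forall>j\<ge>1. y \<noteq> int j - int (b j)"
  define P where "P = (\<lambda>i. i \<ge> 1 \<and> int (part lam i) - int i + 1 \<le> y)"
  \<comment> \<open>A row below the diagram, whose first column has length \<open>b 1\<close>, and
    low enough that \<open>1 - n \<le> y\<close>.\<close>
  define n where "n = b 1 + 1 + nat (1 - y)"
  have "part lam n = 0" using galois[of n 1] by (auto simp: n_def)
  then have "P n" by (simp add: P_def n_def)
  define i where "i = (LEAST i. P i)"
  have "P i" unfolding i_def using \<open>P n\<close> by (rule LeastI)
  then have i: "i \<ge> 1" "int (part lam i) - int i + 1 \<le> y" by (auto simp: P_def)
  have "int (part lam i) - int i + 1 = y"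
  proof (rule ccontr)
    assume "int (part lam i) - int i + 1 \<noteq> y"
    then have lt: "int (part lam i) - int i + 1 < y" using i by simp
    \<comment> \<open>This column turns out to have length \<open>i - 1\<close>, so that
      \<open>j - b j = y\<close>.\<close>
    define j where "j = nat (y + int i - 1)"
    have j: "int j = y + int i - 1" "j \<ge> 1" "part lam i < j" using lt by (auto simp: j_def)
    have "b j < i" using galois[OF i(1) j(2)] j(3) by simp
    moreover have "i - 1 \<le> b j"
    proof (cases "i = 1")
      case False
      then have "\<not> P (i - 1)" using not_less_Least[of "i - 1" P] i by (simp add: i_def)
      then have "int (part lam (i - 1)) - int (i - 1) + 1 > y" using False i by (auto simp: P_def)
      then have "j \<le> part lam (i - 1)" using j i False by (simp add: of_nat_diff)
      then show ?thesis using galois[of "i - 1" j] False i j by auto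
    qed simp
    ultimately have "int (b j) = int i - 1" by linarith
    then have "y = int j - int (b j)" using j by simp
    then show False using * j by blast
  qed
  then show "word lam (y - 1) = 0" using i by (auto simp: word_eq_0_iff)
qed

text \<open>Here the condition defining \<open>DD\<close> enters: on the diagonal, row and column
  numbers agree. The case \<open>b j = j\<close> is impossible, since the box \<open>(j, j)\<close>
  would be present although \<open>part lam j = j - 1\<close>.\<close>

lemma pos_col_iff:
  assumes "1 \<le> j"
  shows "int (b j) - int j > 0 \<longleftrightarrow> j \<le> b j" "int (b j) - int j > 0 \<longleftrightarrow> j \<le> part lam j"
    "int (b j) - int j > 0 \<Longrightarrow> int (b j) - int j = int (part lam j) - int j + 1"
    "int (b j) - int j \<noteq> 0"
  using diag[OF assms] galois[OF assms assms] by linarith+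

text \<open>Positive column numbers are the positive row numbers by \<open>pos_col_iff\<close>; the
  negative ones are the negatives of the positive gaps by \<open>word_complement\<close>.\<close>

lemma anti_pos_beta: "anti (pos_beta lam) = {w. \<exists>j\<ge>1. w = int (b j) - int j}"
proof -
  have pos: "w \<in> pos_beta lam \<longleftrightarrow> (\<exists>j\<ge>1. w = int (b j) - int j)" if "w > 0" for w
  proof
    assume "w \<in> pos_beta lam"
    then obtain i where i: "i \<ge> 1" "w = int (part lam i) - int i + 1"
      by (auto simp: pos_beta_def word_eq_0_iff)
    then have "w = int (b i) - int i" using pos_col_iff[of i] that by auto
    then show "\<exists>j\<ge>1. w = int (b j) - int j" using i by blast
  next
    assume "\<exists>j\<ge>1. w = int (b j) - int j"
    then obtain j where "j \<ge> 1" "w = int (b j) - int j" by blast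
    then have "j \<ge> 1" "w - 1 = int (part lam j) - int j" using pos_col_iff(3)[of j] that by auto
    then show "w \<in> pos_beta lam" using that by (auto simp: pos_beta_def word_eq_0_iff)
  qed
  have neg: "- w \<notin> pos_beta lam \<longleftrightarrow> (\<exists>j\<ge>1. w = int (b j) - int j)" if "w < 0" for w
  proof -
    have "- w \<notin> pos_beta lam \<longleftrightarrow> (\<exists>j\<ge>1. - w = int j - int (b j))"
      using that word_complement[of "- w"] by (auto simp: pos_beta_def)
    moreover have "- w = int j - int (b j) \<longleftrightarrow> w = int (b j) - int j" for j by linarith
    ultimately show ?thesis by simp
  qed
  have "w \<in> anti (pos_beta lam) \<longleftrightarrow> (\<exists>j\<ge>1. w = int (b j) - int j)" for w
  proof -
    consider "w > 0" | "w = 0" | "w < 0" by linarith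
    then show ?thesis
    proof cases
      case 2
      then show ?thesis using pos_col_iff(4) by auto
    qed (use pos neg in \<open>auto simp: anti_def\<close>)
  qed
  then show ?thesis by blast
qed

lemma word_iff_anti: "word lam (y - 1) = 0 \<longleftrightarrow> y \<in> insert 0 (anti (pos_beta lam))"
proof -
  consider "y > 0" | "y = 0" | "y < 0" by linarith
  then show ?thesis
  proof cases
    case 2
    then have "y \<noteq> int j - int (b j)" if "j \<ge> 1" for j using pos_col_iff(4)[OF that] by linarith
    then have "word lam (y - 1) = 0" unfolding word_complement by blast
    then show ?thesis using 2 by simp
  next
    case 3
    have "- y \<in> anti (pos_beta lam) \<longleftrightarrow> (\<exists>j\<ge>1. y = int j - int (b j))"
    proof -
      have "- y = int (b j) - int j \<longleftrightarrow> y = int j - int (b j)" for j by linarith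
      then show ?thesis unfolding anti_pos_beta by simp
    qed
    then show ?thesis using word_complement[of y] anti_uminus[of y] 3 by auto
  qed (auto simp: anti_def pos_beta_def)
qed

lemma bij_boxes_pairs:
  "bij_betw (\<lambda>(i, j). (int (part lam i) - int i + 1, int (b j) - int j)) (boxes lam) (pairs (pos_beta lam))"
proof -
  have inj1: "i = k" if "1 \<le> i" "1 \<le> k" "int (part lam i) - int i = int (part lam k) - int k" for i k
    using that row_antimono[of i k] row_antimono[of k i] by linarith
  have inj2: "i = k" if "1 \<le> i" "1 \<le> k" "int (b i) - int i = int (b k) - int k" for i k
    using that col_antimono[of i k] col_antimono[of k i] by linarith
  show ?thesis
    unfolding bij_betw_def
  proof
    show "inj_on (\<lambda>(i, j). (int (part lam i) - int i + 1, int (b j) - int j)) (boxes lam)"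
      by (rule inj_onI) (auto simp: boxes_def intro: inj1 inj2)
    have "(y, w) \<in> pairs (pos_beta lam) \<longleftrightarrow>
      (y, w) \<in> (\<lambda>(i, j). (int (part lam i) - int i + 1, int (b j) - int j)) ` boxes lam" for y w
    proof
      assume yw: "(y, w) \<in> pairs (pos_beta lam)"
      then have "word lam (y - 1) = 0" "w \<in> anti (pos_beta lam)" "y + w > 0"
        unfolding word_iff_anti by (auto simp: pairs_def)
      then obtain i j where ij: "i \<ge> 1" "y - 1 = int (part lam i) - int i" "j \<ge> 1" "w = int (b j) - int j"
        unfolding anti_pos_beta word_eq_0_iff by auto
      then have y: "y = int (part lam i) - int i + 1" by simp
      have "(i, j) \<in> boxes lam"
        using ij row_col_sum(1)[OF ij(1,3)] \<open>y + w > 0\<close> y by (simp add: boxes_def)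
      then show "(y, w) \<in> (\<lambda>(i, j). (int (part lam i) - int i + 1, int (b j) - int j)) ` boxes lam"
        using ij y by force
    next
      assume "(y, w) \<in> (\<lambda>(i, j). (int (part lam i) - int i + 1, int (b j) - int j)) ` boxes lam"
      then obtain i j where ij: "i \<ge> 1" "j \<ge> 1" "j \<le> part lam i"
        "y = int (part lam i) - int i + 1" "w = int (b j) - int j" by (auto simp: boxes_def)
      have "word lam (y - 1) = 0" using ij by (auto simp: word_eq_0_iff)
      then have "y \<in> insert 0 (anti (pos_beta lam))" by (simp only: word_iff_anti)
      moreover have "w \<in> anti (pos_beta lam)" unfolding anti_pos_beta using ij by blast
      ultimately show "(y, w) \<in> pairs (pos_beta lam)"
        using ij row_col_sum(1)[OF ij(1,2)] by (simp add: pairs_def)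
    qed
    then show "(\<lambda>(i, j). (int (part lam i) - int i + 1, int (b j) - int j)) ` boxes lam = pairs (pos_beta lam)"
      by auto
  qed
qed

lemma hook_length_box:
  assumes "(i, j) \<in> boxes lam"
  shows "int (hook_length lam (i, j)) = int (part lam i) - int i + 1 + (int (b j) - int j)"
proof -
  have ij: "1 \<le> i" "1 \<le> j" "j \<le> part lam i" "i \<le> b j"
    using assms galois by (auto simp: boxes_def)
  have "(k, l) \<in> hook lam (i, j) \<longleftrightarrow>
      (k, l) \<in> Pair i ` {j..part lam i} \<union> (\<lambda>k. (k, j)) ` {i<..b j}" for k l
    using ij galois[of k j] by (cases "k = i"; cases "l = j") (auto simp: boxes_def)
  then have "hook lam (i, j) = Pair i ` {j..part lam i} \<union> (\<lambda>k. (k, j)) ` {i<..b j}"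
    by auto
  also have "card \<dots> = card (Pair i ` {j..part lam i}) + card ((\<lambda>k. (k, j)) ` {i<..b j})"
    by (rule card_Un_disjoint) auto
  also have "\<dots> = (Suc (part lam i) - j) + (b j - i)"
    by (simp add: card_image inj_on_def)
  finally show ?thesis using ij by (simp add: hook_length_def of_nat_diff)
qed

text \<open>Below the diagonal the number of column \<open>j\<close> equals that of row
  \<open>j\<close>, which exceeds that of the lower row \<open>i\<close>. On or above it, the number
  of row \<open>i\<close> equals that of column \<open>i\<close>, which is at least that of column
  \<open>j\<close>.\<close>

lemma eps_box:
  assumes "(i, j) \<in> boxes lam"
  shows "eps (i, j) = pair_sign (int (part lam i) - int i + 1, int (b j) - int j)"
proof -
  have ij: "1 \<le> i" "1 \<le> j" "j \<le> part lam i" "i \<le> b j"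
    using assms galois by (auto simp: boxes_def)
  have "i > j \<longleftrightarrow> int (part lam i) - int i + 1 < int (b j) - int j"
  proof (cases "i > j")
    case True
    then have "int (b j) - int j = int (part lam j) - int j + 1"
      using pos_col_iff[of j] ij by auto
    then show ?thesis using True row_antimono[of j i] ij by auto
  next
    case False
    then have "i \<le> part lam i" using ij by simp
    then have i: "int (part lam i) - int i + 1 = int (b i) - int i" using pos_col_iff[of i] ij by auto
    show ?thesis unfolding i using False col_antimono[of i j] ij by auto
  qed
  then show ?thesis by simp
qed

lemma prod_boxes:
  "(\<Prod>s\<in>boxes lam. F (int (hook_length lam s)) (eps s)) =
   (\<Prod>(y, w)\<in>pairs (pos_beta lam). F (y + w) (pair_sign (y, w)))"
proof -
  have "(\<Prod>s\<in>boxes lam. F (int (hook_length lam s)) (eps s)) =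
    (\<Prod>s\<in>boxes lam. (\<lambda>(y, w). F (y + w) (pair_sign (y, w)))
      ((\<lambda>(i, j). (int (part lam i) - int i + 1, int (b j) - int j)) s))"
  proof (rule prod.cong[OF refl], clarify)
    fix i j assume "(i, j) \<in> boxes lam"
    from hook_length_box[OF this] eps_box[OF this]
    show "F (int (hook_length lam (i, j))) (eps (i, j)) =
      F (int (part lam i) - int i + 1 + (int (b j) - int j))
        (pair_sign (int (part lam i) - int i + 1, int (b j) - int j))" by simp
  qed
  also have "\<dots> = (\<Prod>(y, w)\<in>pairs (pos_beta lam). F (y + w) (pair_sign (y, w)))"
    using bij_boxes_pairs by (rule prod.reindex_bij_betw)
  finally show ?thesis .
qed

lemma card_boxes: "card (boxes lam) = card (pairs (pos_beta lam))"
  using bij_boxes_pairs by (rule bij_betw_same_card)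

lemma finite_pos_beta: "finite (pos_beta lam)"
proof -
  have "pos_beta lam \<subseteq> {0..int (part lam 1)}"
    using row_antimono[of 1] by (fastforce simp: pos_beta_def word_eq_0_iff)
  then show ?thesis by (rule finite_subset) auto
qed

end

section \<open>Size as a count of boxes; words of the empty partition and of rectangles\<close>

lemma sum_list_eq_card_boxes: "sum_list lam = card (boxes lam)"
proof -
  have "boxes lam = (SIGMA i:{1..length lam}. {1..part lam i})"
    by (auto simp: boxes_def part_def split: if_splits)
  then have "card (boxes lam) = (\<Sum>i\<in>{1..length lam}. part lam i)" by (simp add: card_SigmaI)
  also have "\<dots> = (\<Sum>i\<in>{0..<length lam}. lam ! i)"
    by (rule sum.reindex_bij_witness[where i = Suc and j = "\<lambda>i. i - 1"]) (auto simp: part_def)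
  finally show ?thesis by (simp add: sum_list_sum_nth)
qed

lemma word_Nil: "word [] i = 0 \<longleftrightarrow> i < 0"
proof
  assume "i < 0"
  then have "nat (- i) \<ge> 1" "i = int (part [] (nat (- i))) - int (nat (- i))" by (auto simp: part_def)
  then show "word [] i = 0" unfolding word_eq_0_iff by blast
qed (auto simp: word_eq_0_iff part_def)

text \<open>The first \<open>m\<close> rows give \<open>m - 2\<close> down to \<open>- 1\<close>,
  the empty rows beyond them everything below \<open>- m\<close>. The case \<open>m = 1\<close>,
  where the list is empty, fits the same pattern.\<close>

lemma word_rectangle:
  assumes "m \<ge> 1"
  shows "word (rectangle m (m - 1)) i = 0 \<longleftrightarrow> (- 1 \<le> i \<and> i \<le> int m - 2) \<or> i < - int m"
proof -
  have p: "part (rectangle m (m - 1)) k = (if 1 \<le> k \<and> k \<le> m then m - 1 else 0)" for k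
    using assms by (auto simp: part_def rectangle_def)
  show ?thesis
  proof
    assume "(- 1 \<le> i \<and> i \<le> int m - 2) \<or> i < - int m"
    then show "word (rectangle m (m - 1)) i = 0"
    proof
      assume "- 1 \<le> i \<and> i \<le> int m - 2"
      then have "nat (int m - 1 - i) \<ge> 1"
        "i = int (part (rectangle m (m - 1)) (nat (int m - 1 - i))) - int (nat (int m - 1 - i))"
        unfolding p using assms by (auto simp: of_nat_diff)
      then show ?thesis unfolding word_eq_0_iff by blast
    next
      assume "i < - int m"
      then have "nat (- i) \<ge> 1"
        "i = int (part (rectangle m (m - 1)) (nat (- i))) - int (nat (- i))"
        unfolding p by auto
      then show ?thesis unfolding word_eq_0_iff by blast
    qed
  next
    assume "word (rectangle m (m - 1)) i = 0"
    then obtain k where "k \<ge> 1" "i = int (if 1 \<le> k \<and> k \<le> m then m - 1 else 0) - int k"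
      unfolding word_eq_0_iff p by blast
    then show "(- 1 \<le> i \<and> i \<le> int m - 2) \<or> i < - int m"
      using assms by (cases "k \<le> m") (auto simp: of_nat_diff)
  qed
qed

subsection \<open>Quotient and coding\<close>

text \<open>Shifting word indices by one turns quotient component \<open>c - 1\<close> into the
  residue class of \<open>c\<close>, and the last component into the class of 0. An empty component
  yields a ray; the rectangle is known only up to a shift \<open>M\<close>.\<close>

lemma DD1'_class_cases:
  assumes lam: "lam \<in> DD1' g" and g: "g \<ge> 1"
  shows "\<And>c. c \<in> {1..<g} \<Longrightarrow> \<exists>m. \<forall>n. word lam (int g * n + int c - 1) = 0 \<longleftrightarrow> n < m"
    and "\<exists>M m. m \<ge> 1 \<and> (\<forall>n. word lam (int g * n - 1) = 0 \<longleftrightarrow>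
      (M \<le> n \<and> n \<le> M + m - 1) \<or> n < M + 1 - m)"
proof -
  obtain \<nu> m where q: "is_quotient g lam \<nu>" "\<And>k. k < g \<Longrightarrow> k \<noteq> g - 1 \<Longrightarrow> \<nu> ! k = []"
    "m \<ge> 1" "\<nu> ! (g - 1) = rectangle m (m - 1)"
    using lam by (auto simp: DD1'_def)
  have sh: "\<exists>m. \<forall>i. word (\<nu> ! k) i = word lam (int g * (i + m) + int k)" if "k < g" for k
    using q(1) that by (auto simp: is_quotient_def)
  show "\<exists>m. \<forall>n. word lam (int g * n + int c - 1) = 0 \<longleftrightarrow> n < m" if c: "c \<in> {1..<g}" for c
  proof -
    have k: "c - 1 < g" "c - 1 \<noteq> g - 1" using c by auto
    obtain p where p: "\<And>i. word [] i = word lam (int g * (i + p) + int (c - 1))"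
      using sh[OF k(1)] q(2)[OF k] by auto
    have "word lam (int g * n + int c - 1) = 0 \<longleftrightarrow> n < p" for n
      using p[of "n - p"] word_Nil[of "n - p"] c by (simp add: of_nat_diff add_diff_eq)
    then show ?thesis by blast
  qed
  obtain p where p: "\<And>i. word (rectangle m (m - 1)) i = word lam (int g * (i + p) + int (g - 1))"
    using sh[of "g - 1"] q(4) g by auto
  have "word lam (int g * n - 1) = 0 \<longleftrightarrow>
      (p \<le> n \<and> n \<le> p + int m - 1) \<or> n < p + 1 - int m" for n
  proof -
    have "int g * (n - 1 - p + p) + int (g - 1) = int g * n - 1"
      using g by (simp add: of_nat_diff algebra_simps)
    then have "word lam (int g * n - 1) = 0 \<longleftrightarrow> word (rectangle m (m - 1)) (n - 1 - p) = 0"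
      using p[of "n - 1 - p"] by metis
    then show ?thesis unfolding word_rectangle[OF q(3)] by linarith
  qed
  moreover have "int m \<ge> 1" using q(3) by simp
  ultimately show "\<exists>M m. m \<ge> 1 \<and> (\<forall>n. word lam (int g * n - 1) = 0 \<longleftrightarrow>
      (M \<le> n \<and> n \<le> M + m - 1) \<or> n < M + 1 - m)"
    by blast
qed

text \<open>\<open>f\<close> holds on a block of length \<open>m\<close> from \<open>M\<close> on
  and on a ray ending before a gap of length \<open>m - 1\<close>. If 0 lies in the ray, then both
  \<open>M\<close> and \<open>- M\<close> satisfy \<open>f\<close>. If \<open>M < 0\<close> and 0
  lies in the block, then \<open>M\<close> inside and \<open>M - 1\<close> outside force
  \<open>- M\<close> out and \<open>1 - M\<close> in, which is impossible above the block.\<close>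

lemma symmetric_rectangle_shift_eq_0:
  fixes M m :: int
  assumes f: "\<And>n. f n \<longleftrightarrow> (M \<le> n \<and> n \<le> M + m - 1) \<or> n < M + 1 - m"
    and sym: "\<And>n. n \<noteq> 0 \<Longrightarrow> f (- n) \<longleftrightarrow> \<not> f n" and f0: "f 0" and m: "m \<ge> 1"
  shows "M = 0"
proof (rule ccontr)
  assume M: "M \<noteq> 0"
  consider "0 < M + 1 - m" | "M < 0" "0 \<le> M + m - 1" using f0 f[of 0] M by linarith
  then show False
  proof cases
    case 1
    then have "M = m" using sym[of 1] f[of 1] f[of "- 1"] m sym[of M] f[of M] f[of "- M"] M by linarith
    then show False using sym[of m] f[of m] f[of "- m"] m by linarith
  next
    case 2
    then show False using sym[of M] sym[of "M - 1"] f[of M] f[of "- M"] f[of "M - 1"] f[of "1 - M"]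
      by simp
  qed
qed

text \<open>Antisymmetry settles the two self-opposite classes: the rectangle has shift 0, and the
  ray in the class of \<open>t\<close> ends at \<open>- t\<close>. The size of the rectangle gives
  \<open>\<rho> t\<close>, the rays in the classes of \<open>t + j\<close> give the other
  \<open>\<rho> j\<close>.\<close>

lemma DD1'_coded:
  assumes lam: "lam \<in> DD1' (2 * t)" and t: "t \<ge> 1"
  obtains \<rho> where "coded t \<rho> (pos_beta lam)"
proof -
  define D where "D = pos_beta lam"
  define g where "g = 2 * int t"
  have "lam \<in> DD'" using lam by (simp add: DD1'_def)
  then obtain b where b: "\<And>i j. 1 \<le> i \<Longrightarrow> 1 \<le> j \<Longrightarrow> j \<le> part lam i \<longleftrightarrow> i \<le> b j"
    "\<And>i. 1 \<le> i \<Longrightarrow> i \<le> b i \<Longrightarrow> b i = part lam i + 1"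
    by (rule DD'_parts) blast
  have W: "word lam (y - 1) = 0 \<longleftrightarrow> y \<in> insert 0 (anti D)" for y
    unfolding D_def using b by (rule word_iff_anti)
  have W': "y \<in> anti D \<longleftrightarrow> word lam (y - 1) = 0" if "y \<noteq> 0" for y using that by (simp add: W)
  have sym: "word lam (- y - 1) = 0 \<longleftrightarrow> \<not> word lam (y - 1) = 0" if "y \<noteq> 0" for y
    using that anti_uminus[of y D] unfolding W by simp
  have gg: "int (2 * t) = g" by (simp add: g_def)
  have "\<forall>c. \<exists>m. c \<in> {1..<2 * t} \<longrightarrow> (\<forall>n. word lam (g * n + int c - 1) = 0 \<longleftrightarrow> n < m)"
    using DD1'_class_cases(1)[OF lam, unfolded gg] t by auto
  then obtain n where n: "\<And>c k. c \<in> {1..<2 * t} \<Longrightarrow> word lam (g * k + int c - 1) = 0 \<longleftrightarrow> k < n c"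
    by metis
  obtain M m where m: "m \<ge> 1" and M: "\<And>k. word lam (g * k - 1) = 0 \<longleftrightarrow>
      (M \<le> k \<and> k \<le> M + m - 1) \<or> k < M + 1 - m"
    using DD1'_class_cases(2)[OF lam, unfolded gg] t by auto
  have "M = 0"
    using M
  proof (rule symmetric_rectangle_shift_eq_0)
    fix k :: int assume "k \<noteq> 0"
    then show "word lam (g * - k - 1) = 0 \<longleftrightarrow> \<not> word lam (g * k - 1) = 0"
      using sym[of "g * k"] t by (simp add: g_def)
  qed (use W[of 0] m in auto)
  have nt: "n t = 0"
  proof -
    \<comment> \<open>Negation sends \<open>g * k + t\<close> to \<open>g * (- k - 1) + t\<close>,
      so the reflection taking \<open>k\<close> to \<open>- k - 1\<close> exchanges the ray with its
      complement, which fixes its end.\<close>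
    have "k < n t \<longleftrightarrow> \<not> (- k - 1 < n t)" for k
    proof -
      have "g * k + int t \<noteq> 0"
      proof
        assume "g * k + int t = 0"
        then have "int t * (2 * k + 1) = 0" by (simp add: g_def algebra_simps)
        then have "2 * k + 1 = 0" using t by simp
        then show False by presburger
      qed
      moreover have "- (g * k + int t) = g * (- k - 1) + int t" by (simp add: g_def algebra_simps)
      ultimately have "word lam (g * (- k - 1) + int t - 1) = 0 \<longleftrightarrow> \<not> word lam (g * k + int t - 1) = 0"
        using sym by metis
      then show ?thesis using n[of t k] n[of t "- k - 1"] t by simp
    qed
    from this[of 0] this[of "- 1"] this[of 1] show ?thesis by linarith
  qed
  \<comment> \<open>The class of \<open>t + j\<close> has top element
    \<open>g * (n (t + j) - 1) + t + j\<close>, and the class of 0 has top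
    \<open>g * (m - 1)\<close>; adding \<open>t\<close> gives these values.\<close>
  define \<rho> where "\<rho> = (\<lambda>j. if j = t then int t + g * (m - 1) else g * n (t + j) + int j)"
  have g: "g > 0" using t by (simp add: g_def)
  have le: "g * k \<le> g * l \<longleftrightarrow> k \<le> l" for k l using g by simp
  have "coded t \<rho> D"
    unfolding coded_def g_def[symmetric]
  proof (intro conjI ballI allI impI)
    show "g dvd \<rho> j - int j" if "j \<in> {1..t}" for j by (auto simp: \<rho>_def)
    show "0 < \<rho> t" using t g m by (simp add: \<rho>_def add_pos_nonneg)
  next
    fix j w assume j: "j \<in> {1..<t}" and w: "g dvd w - (int j - int t)"
    then obtain k where "w - (int j - int t) = g * k" by blast
    then have w: "w = g * (k - 1) + int (t + j)" by (simp add: g_def algebra_simps)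
    have "w \<noteq> 0"
    proof
      assume "w = 0"
      then have "g dvd int (t + j)" using w by (metis dvd_add_right_iff dvd_triv_left dvd_0_right)
      then show False using j zdvd_imp_le[of g "int (t + j)"] by (auto simp: g_def)
    qed
    then have "w \<in> anti D \<longleftrightarrow> k - 1 < n (t + j)"
      using W' n[of "t + j" "k - 1"] j by (simp add: w)
    also have "\<dots> \<longleftrightarrow> g * k \<le> g * n (t + j)" unfolding le by auto
    also have "\<dots> \<longleftrightarrow> w \<le> \<rho> j - int t" using j by (simp add: w \<rho>_def) (simp add: g_def algebra_simps)
    finally show "w \<in> anti D \<longleftrightarrow> w \<le> \<rho> j - int t" .
  next
    fix w assume w: "g dvd w - int t"
    then obtain k where "w - int t = g * k" by blast
    then have w: "w = g * k + int t" by simp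
    have "w \<noteq> 0"
    proof
      assume "w = 0"
      then have "g dvd int t" using w by (metis dvd_add_right_iff dvd_triv_left dvd_0_right)
      then show False using t zdvd_imp_le[of g "int t"] by (auto simp: g_def)
    qed
    then have "w \<in> anti D \<longleftrightarrow> k < 0" using W' n[of t k] t nt by (simp add: w)
    also have "\<dots> \<longleftrightarrow> g * k \<le> g * (- 1)" unfolding le by auto
    also have "\<dots> \<longleftrightarrow> w \<le> - int t"
    proof -
      have "g * (- 1) = - int t - int t" by (simp add: g_def)
      then show ?thesis unfolding w by linarith
    qed
    finally show "w \<in> anti D \<longleftrightarrow> w \<le> - int t" .
  next
    fix w assume w: "0 < w" "g dvd w"
    then obtain k where k: "w = g * k" by blast
    then have "k > 0" using w g by (simp add: zero_less_mult_iff)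
    have "w \<in> anti D \<longleftrightarrow> word lam (g * k - 1) = 0" using W'[of w] w(1) unfolding k by linarith
    also have "\<dots> \<longleftrightarrow> k \<le> m - 1" unfolding M using \<open>M = 0\<close> \<open>k > 0\<close> m by auto
    finally have "w \<in> anti D \<longleftrightarrow> k \<le> m - 1" .
    then show "w \<in> anti D \<longleftrightarrow> w \<le> \<rho> t - int t" using g by (simp add: k \<rho>_def)
  qed
  then show thesis using that by (simp add: D_def)
qed

text \<open>\<open>M\<close> is the top of its class in the shifted coordinate: the word index is
  \<open>M - 1\<close>, and the coding adds one period \<open>g\<close>.\<close>

lemma beta_eq:
  assumes g: "g > 0" and M: "int g dvd M - int i - 1" "word lam (M - 1) = 0"
    and le: "\<And>w. int g dvd w - M \<Longrightarrow> word lam (w - 1) = 0 \<Longrightarrow> w \<le> M"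
  shows "beta g lam i = M + int g - 1"
  unfolding beta_def
proof (rule Greatest_equality)
  obtain k where "M - int i - 1 = int g * k" using M by blast
  then have "M + int g - 1 = (k + 1) * int g + int i" "k * int g + int i = M - 1"
    by (simp_all add: algebra_simps)
  then show "\<exists>k. M + int g - 1 = (k + 1) * int g + int i \<and> word lam (k * int g + int i) = 0"
    using M by metis
next
  fix y assume "\<exists>k. y = (k + 1) * int g + int i \<and> word lam (k * int g + int i) = 0"
  then obtain k where k: "y = (k + 1) * int g + int i" "word lam (k * int g + int i) = 0" by blast
  have "k * int g + int i + 1 - M = k * int g - (M - int i - 1)" by simp
  then have "int g dvd k * int g + int i + 1 - M" using M(1) by (metis dvd_diff dvd_triv_right)
  then have "k * int g + int i + 1 \<le> M" using le[of "k * int g + int i + 1"] k by simp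
  then show "y \<le> M + int g - 1" by (simp add: k algebra_simps)
qed

text \<open>A class with top \<open>M\<close> yields \<open>M + 2 * t - 1\<close>. The class of
  \<open>t\<close> has top \<open>- t\<close> and yields the entry 0, the class of 0 yields
  \<open>\<rho> t\<close>, and each opposite pair yields \<open>\<rho> j\<close> and
  \<open>- \<rho> j\<close>, always up to the shift \<open>t - 1\<close>. Thus the \<open>t\<close>
  numbers \<open>\<bar>\<rho> j\<bar>\<close> lead the list.\<close>

lemma beta_image_coded:
  assumes cd: "coded t \<rho> D" and t: "t \<ge> 1" and W: "\<And>y. word lam (y - 1) = 0 \<longleftrightarrow> y \<in> insert 0 (anti D)"
  shows "beta (2 * t) lam ` {0..<2 * t} =
    (\<lambda>x. x + int t - 1) ` (insert 0 ((\<lambda>j. - \<bar>\<rho> j\<bar>) ` {1..<t}) \<union> (\<lambda>j. \<bar>\<rho> j\<bar>) ` {1..t})"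
proof -
  define B where "B = beta (2 * t) lam"
  have g: "2 * t > 0" "int (2 * t) = 2 * int t" using t by auto
  have rj: "2 * int t dvd \<rho> j - int j" if "j \<in> {1..t}" for j using that cd by (auto simp: coded_def)
  have rt: "2 * int t dvd \<rho> t - int t" "\<rho> t > 0" using cd t by (auto simp: coded_def)
  have rt': "\<rho> t \<ge> int t"
    using dvd_less_imp_nonpos[of "2 * int t" "int t - \<rho> t"] rt by (simp add: dvd_diff_commute)
  have nz: "\<not> 2 * int t dvd s * int j - int t" if "j \<in> {0..<t}" "s \<in> {1, - 1}" for j s
    using that dvd_imp_le_int[of "s * int j - int t" "2 * int t"] by auto
  have Bt: "B (t - 1) = 0 + int t - 1"
  proof -
    have "B (t - 1) = - int t + int (2 * t) - 1"
      unfolding B_def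
    proof (rule beta_eq[OF g(1)])
      have e: "- int t - int (t - 1) - 1 = - (2 * int t)" using t by (simp add: of_nat_diff)
      show "int (2 * t) dvd - int t - int (t - 1) - 1" unfolding e by simp
      have d: "2 * int t dvd w - int t" if "2 * int t dvd w - - int t" for w
        using dvd_diff[OF that dvd_refl] by simp
      show "word lam (- int t - 1) = 0"
        unfolding W using cd d[of "- int t"] by (simp add: coded_def)
      fix w assume w: "int (2 * t) dvd w - - int t" "word lam (w - 1) = 0"
      have "w \<noteq> 0" using w(1) nz[of 0 1] t by (auto simp: dvd_diff_commute)
      then show "w \<le> - int t" using w(2) d[of w] w(1) cd unfolding W g(2) by (simp add: coded_def)
    qed
    then show ?thesis by simp
  qed
  have B0: "B (2 * t - 1) = \<rho> t + int t - 1"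
  proof -
    have "B (2 * t - 1) = \<rho> t - int t + int (2 * t) - 1"
      unfolding B_def
    proof (rule beta_eq[OF g(1)])
      have e: "\<rho> t - int t - int (2 * t - 1) - 1 = \<rho> t - int t - 2 * int t"
        using t by (simp add: of_nat_diff)
      show "int (2 * t) dvd \<rho> t - int t - int (2 * t - 1) - 1"
        unfolding e g(2) by (rule dvd_diff[OF rt(1) dvd_refl])
      \<comment> \<open>If \<open>\<rho> t = t\<close>, this top is 0, a beta number although it is
        not in \<open>anti D\<close>.\<close>
      show "word lam (\<rho> t - int t - 1) = 0"
        unfolding W using coded_zero[OF cd t rt(1)] rt' by auto
      fix w assume w: "int (2 * t) dvd w - (\<rho> t - int t)" "word lam (w - 1) = 0"
      have "2 * int t dvd w" using dvd_add[OF w(1)[unfolded g(2)] rt(1)] by simp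
      from coded_zero[OF cd t this] show "w \<le> \<rho> t - int t"
        using w(2) rt' unfolding W by auto
    qed
    then show ?thesis by simp
  qed
  have Bp: "B (t + j - 1) = \<rho> j + int t - 1" if j: "j \<in> {1..<t}" for j
  proof -
    have r: "2 * int t dvd \<rho> j - int j" using rj j by simp
    have "B (t + j - 1) = \<rho> j - int t + int (2 * t) - 1"
      unfolding B_def
    proof (rule beta_eq[OF g(1)])
      have e: "\<rho> j - int t - int (t + j - 1) - 1 = \<rho> j - int j - 2 * int t"
        using t by (simp add: of_nat_diff)
      show "int (2 * t) dvd \<rho> j - int t - int (t + j - 1) - 1"
        unfolding e g(2) by (rule dvd_diff[OF r dvd_refl])
      show "word lam (\<rho> j - int t - 1) = 0"
        unfolding W using cd j r by (simp add: coded_def)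
      fix w assume w: "int (2 * t) dvd w - (\<rho> j - int t)" "word lam (w - 1) = 0"
      have e: "w - (int j - int t) = w - (\<rho> j - int t) + (\<rho> j - int j)" by simp
      have w': "2 * int t dvd w - (int j - int t)"
        unfolding e by (rule dvd_add[OF w(1)[unfolded g(2)] r])
      have "w \<noteq> 0"
      proof
        assume "w = 0"
        then have "2 * int t dvd - (1 * int j - int t)" using w' by simp
        then show False using nz[of j 1] j unfolding dvd_minus_iff by simp
      qed
      then show "w \<le> \<rho> j - int t" using w(2) w' cd j unfolding W by (simp add: coded_def)
    qed
    then show ?thesis by simp
  qed
  have Bm: "B (t - j - 1) = - \<rho> j + int t - 1" if j: "j \<in> {1..<t}" for j
  proof -
    have r: "2 * int t dvd \<rho> j - int j" using rj j by simp
    have "B (t - j - 1) = - \<rho> j - int t + int (2 * t) - 1"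
      unfolding B_def
    proof (rule beta_eq[OF g(1)])
      have e: "- \<rho> j - int t - int (t - j - 1) - 1 = - (\<rho> j - int j + 2 * int t)"
        using j by (simp add: of_nat_diff)
      show "int (2 * t) dvd - \<rho> j - int t - int (t - j - 1) - 1"
        unfolding e g(2) dvd_minus_iff by (rule dvd_add[OF r dvd_refl])
      have e: "- \<rho> j - int t - (- int j - int t) = - (\<rho> j - int j)" by simp
      have "2 * int t dvd - \<rho> j - int t - (- int j - int t)" unfolding e dvd_minus_iff by (rule r)
      from coded_neg[OF cd j this] show "word lam (- \<rho> j - int t - 1) = 0" unfolding W by simp
      fix w assume w: "int (2 * t) dvd w - (- \<rho> j - int t)" "word lam (w - 1) = 0"
      have e: "w - (- int j - int t) = w - (- \<rho> j - int t) - (\<rho> j - int j)" by simp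
      have w': "2 * int t dvd w - (- int j - int t)"
        unfolding e by (rule dvd_diff[OF w(1)[unfolded g(2)] r])
      have "w \<noteq> 0"
      proof
        assume "w = 0"
        then have "2 * int t dvd - (- 1 * int j - int t)" using w' by simp
        then show False using nz[of j "- 1"] j unfolding dvd_minus_iff by simp
      qed
      then show "w \<le> - \<rho> j - int t" using w(2) coded_neg[OF cd j w'] unfolding W by simp
    qed
    then show ?thesis by simp
  qed
  have dec: "{0..<2 * t} = {t - 1, 2 * t - 1} \<union> (\<lambda>j. t + j - 1) ` {1..<t} \<union> (\<lambda>j. t - j - 1) ` {1..<t}"
  proof (intro equalityI subsetI)
    fix i assume i: "i \<in> {0..<2 * t}"
    consider "i = t - 1" | "i = 2 * t - 1" | "i < t - 1" | "t - 1 < i" "i < 2 * t - 1"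
      using i by fastforce
    then show "i \<in> {t - 1, 2 * t - 1} \<union> (\<lambda>j. t + j - 1) ` {1..<t} \<union> (\<lambda>j. t - j - 1) ` {1..<t}"
    proof cases
      case 3
      then have "i = t - (t - 1 - i) - 1" "t - 1 - i \<in> {1..<t}" by auto
      then show ?thesis by blast
    next
      case 4
      then have "i = t + (i + 1 - t) - 1" "i + 1 - t \<in> {1..<t}" by auto
      then show ?thesis by blast
    qed auto
  qed (use t in auto)
  have "B ` {0..<2 * t} = (\<lambda>x. x + int t - 1) ` ({0, \<rho> t} \<union> \<rho> ` {1..<t} \<union> (\<lambda>j. - \<rho> j) ` {1..<t})"
    unfolding dec image_Un image_image using Bt B0 Bp Bm by (simp add: image_def)
  also have "{0, \<rho> t} \<union> \<rho> ` {1..<t} \<union> (\<lambda>j. - \<rho> j) ` {1..<t} =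
      insert 0 ((\<lambda>j. - \<bar>\<rho> j\<bar>) ` {1..<t}) \<union> (\<lambda>j. \<bar>\<rho> j\<bar>) ` {1..t}" (is "?L = ?R")
  proof -
    have "{1..t} = insert t {1..<t}" using t by auto
    then have "?R = insert 0 (insert (\<rho> t) ((\<lambda>j. - \<bar>\<rho> j\<bar>) ` {1..<t} \<union> (\<lambda>j. \<bar>\<rho> j\<bar>) ` {1..<t}))"
      using rt by auto
    also have "(\<lambda>j. - \<bar>\<rho> j\<bar>) ` {1..<t} \<union> (\<lambda>j. \<bar>\<rho> j\<bar>) ` {1..<t} = \<rho> ` {1..<t} \<union> (\<lambda>j. - \<rho> j) ` {1..<t}"
      unfolding set_eq_iff by (auto simp: image_iff abs_if)
    finally show ?thesis by auto
  qed
  finally show ?thesis by (simp add: B_def)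
qed

section \<open>Enumerating the coding in decreasing order\<close>

lemma take_rev_sorted_list_of_set:
  fixes P N :: "'a::linorder set"
  assumes fin: "finite N" "finite P" and less: "\<And>x y. x \<in> N \<Longrightarrow> y \<in> P \<Longrightarrow> x < y"
  shows "take (card P) (rev (sorted_list_of_set (N \<union> P))) = rev (sorted_list_of_set P)"
proof -
  have "sorted_list_of_set (N \<union> P) = sorted_list_of_set N @ sorted_list_of_set P"
  proof (rule sorted_distinct_set_unique)
    show "sorted (sorted_list_of_set N @ sorted_list_of_set P)"
      using fin less by (auto simp: sorted_append intro: less_imp_le)
    show "distinct (sorted_list_of_set N @ sorted_list_of_set P)"
      using fin less by fastforce
  qed (use fin in auto)
  then show ?thesis by simp
qed

lemma rev_sorted_list_of_set_nth:
  fixes P :: "'a::linorder set"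
  assumes "finite P"
  shows "\<And>i j. 1 \<le> i \<Longrightarrow> i < j \<Longrightarrow> j \<le> card P \<Longrightarrow>
      rev (sorted_list_of_set P) ! (j - 1) < rev (sorted_list_of_set P) ! (i - 1)"
    and "(\<lambda>i. rev (sorted_list_of_set P) ! (i - 1)) ` {1..card P} = P"
proof -
  define L where "L = rev (sorted_list_of_set P)"
  have len: "length L = card P" by (simp add: L_def)
  have "sorted_wrt (\<lambda>x y. y < x) L"
    unfolding L_def sorted_wrt_rev by simp
  then show "L ! (j - 1) < L ! (i - 1)" if "1 \<le> i" "i < j" "j \<le> card P" for i j
    using that len by (simp add: sorted_wrt_iff_nth_less)
  have "(\<lambda>i. L ! (i - 1)) ` {1..card P} = set L"
  proof -
    have "(\<lambda>i. L ! (i - 1)) ` {1..card P} = (\<lambda>i. L ! i) ` (\<lambda>i. i - 1) ` {1..card P}"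
      by (simp add: image_image)
    also have "(\<lambda>i. i - 1) ` {1..card P} = {0..<card P}"
      by (auto simp: image_iff intro!: bexI[of _ "Suc _"])
    also have "(\<lambda>i. L ! i) ` {0..<card P} = set L"
      using nth_image[of "card P" L] len by simp
    finally show ?thesis .
  qed
  then show "(\<lambda>i. L ! (i - 1)) ` {1..card P} = P" using assms by (simp add: L_def)
qed

lemma vand_enumerate:
  fixes r :: "nat \<Rightarrow> int"
  assumes dec: "\<And>i j. 1 \<le> i \<Longrightarrow> i < j \<Longrightarrow> j \<le> t \<Longrightarrow> r j < r i"
  shows "vand \<sigma> (r ` {1..t}) = (\<Prod>i=1..t. \<sigma> (r i)) *
    (\<Prod>(i, j)\<in>{(i, j). 1 \<le> i \<and> i < j \<and> j \<le> t}. \<sigma> (r i - r j) * \<sigma> (r i + r j))"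
proof -
  have inj: "inj_on r {1..t}"
  proof (rule inj_onI)
    fix i j assume "i \<in> {1..t}" "j \<in> {1..t}" "r i = r j"
    then show "i = j" using dec[of i j] dec[of j i] by (cases i j rule: linorder_cases) auto
  qed
  have "{(a, c). a \<in> r ` {1..t} \<and> c \<in> r ` {1..t} \<and> a < c} =
      (\<lambda>(i, j). (r j, r i)) ` {(i, j). 1 \<le> i \<and> i < j \<and> j \<le> t}"
  proof (intro equalityI subsetI)
    fix p assume "p \<in> {(a, c). a \<in> r ` {1..t} \<and> c \<in> r ` {1..t} \<and> a < c}"
    then obtain i j where ij: "i \<in> {1..t}" "j \<in> {1..t}" "p = (r j, r i)" "r j < r i" by auto
    then have "i < j" using dec[of j i] by (cases i j rule: linorder_cases) auto
    then show "p \<in> (\<lambda>(i, j). (r j, r i)) ` {(i, j). 1 \<le> i \<and> i < j \<and> j \<le> t}" using ij by auto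
  qed (use dec in auto)
  moreover have "inj_on (\<lambda>(i, j). (r j, r i)) {(i, j). 1 \<le> i \<and> i < j \<and> j \<le> t}"
    by (rule inj_onI) (auto dest: inj_onD[OF inj])
  ultimately have "(\<Prod>(a, b)\<in>{(a, b). a \<in> r ` {1..t} \<and> b \<in> r ` {1..t} \<and> a < b}. \<sigma> (b - a) * \<sigma> (b + a)) =
      (\<Prod>p\<in>{(i, j). 1 \<le> i \<and> i < j \<and> j \<le> t}.
        (\<lambda>(a, b). \<sigma> (b - a) * \<sigma> (b + a)) ((\<lambda>(i, j). (r j, r i)) p))"
    by (simp only: prod.reindex comp_def)
  also have "\<dots> = (\<Prod>(i, j)\<in>{(i, j). 1 \<le> i \<and> i < j \<and> j \<le> t}. \<sigma> (r i - r j) * \<sigma> (r i + r j))"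
    by (intro prod.cong) (auto split: prod.splits)
  finally have "(\<Prod>(a, b)\<in>{(a, b). a \<in> r ` {1..t} \<and> b \<in> r ` {1..t} \<and> a < b}. \<sigma> (b - a) * \<sigma> (b + a)) =
      (\<Prod>(i, j)\<in>{(i, j). 1 \<le> i \<and> i < j \<and> j \<le> t}. \<sigma> (r i - r j) * \<sigma> (r i + r j))" .
  moreover have "prod \<sigma> (r ` {1..t}) = (\<Prod>i=1..t. \<sigma> (r i))"
    using inj by (simp add: prod.reindex)
  ultimately show ?thesis by (simp only: vand_def)
qed

text \<open>The argument \<open>h - \<epsilon> * g\<close> is negative only if
  \<open>\<epsilon> = 1\<close> and \<open>h < g\<close>. It is then \<open>- i\<close> with
  \<open>i = g - h\<close>, and replacing \<open>\<tau> (- i)\<close> by \<open>\<tau> i\<close>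
  costs the factor \<open>\<tau> (- i) / \<tau> i\<close>; \<open>alpha\<close> counts these boxes
  by \<open>i\<close>.\<close>

lemma prod_hook_abs:
  fixes \<tau> :: "int \<Rightarrow> 'a::field"
  assumes nz: "\<And>k. \<tau> k \<noteq> 0" and fin: "finite (boxes lam)"
  shows "(\<Prod>s\<in>boxes lam. \<tau> (int (hook_length lam s) - eps s * int g) / \<tau> (int (hook_length lam s))) =
    (\<Prod>i=1..g-1. (\<tau> (- int i) / \<tau> (int i)) ^ alpha g lam i) *
    (\<Prod>s\<in>boxes lam. \<tau> \<bar>int (hook_length lam s) - eps s * int g\<bar> / \<tau> \<bar>int (hook_length lam s)\<bar>)"
proof -
  define h where "h = hook_length lam"
  define Q where "Q = (\<lambda>i. \<tau> (- int i) / \<tau> (int i))"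
  define S where "S = {s \<in> boxes lam. eps s = 1 \<and> h s < g}"
  have hpos: "h s > 0" if "s \<in> boxes lam" for s
  proof -
    obtain i j where s: "s = (i, j)" by (cases s)
    have "hook lam s \<subseteq> boxes lam" "s \<in> hook lam s" using that by (auto simp: s)
    then show ?thesis
      unfolding h_def hook_length_def using fin finite_subset card_gt_0_iff by blast
  qed
  have eps: "eps s = 1 \<or> eps s = - 1" for s by (cases s) auto
  have "(\<Prod>s\<in>boxes lam. \<tau> (int (h s) - eps s * int g) / \<tau> (int (h s))) =
    (\<Prod>s\<in>boxes lam. (if eps s = 1 \<and> h s < g then Q (g - h s) else 1) *
      (\<tau> \<bar>int (h s) - eps s * int g\<bar> / \<tau> \<bar>int (h s)\<bar>))"
  proof (rule prod.cong[OF refl])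
    fix s assume "s \<in> boxes lam"
    show "\<tau> (int (h s) - eps s * int g) / \<tau> (int (h s)) =
      (if eps s = 1 \<and> h s < g then Q (g - h s) else 1) *
      (\<tau> \<bar>int (h s) - eps s * int g\<bar> / \<tau> \<bar>int (h s)\<bar>)"
    proof (cases "eps s = 1 \<and> h s < g")
      case True
      then have "int (h s) - eps s * int g = - int (g - h s)" by (simp add: of_nat_diff)
      then show ?thesis using True nz by (simp add: Q_def)
    next
      case False
      then have "int (h s) - eps s * int g \<ge> 0" using eps[of s] by auto
      then show ?thesis unfolding if_not_P[OF False] by simp
    qed
  qed
  also have "\<dots> = (\<Prod>s\<in>boxes lam. if eps s = 1 \<and> h s < g then Q (g - h s) else 1) *
      (\<Prod>s\<in>boxes lam. \<tau> \<bar>int (h s) - eps s * int g\<bar> / \<tau> \<bar>int (h s)\<bar>)"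
    by (rule prod.distrib)
  also have "(\<Prod>s\<in>boxes lam. if eps s = 1 \<and> h s < g then Q (g - h s) else 1) = (\<Prod>s\<in>S. Q (g - h s))"
    unfolding S_def using fin by (rule prod.inter_filter[symmetric])
  also have "\<dots> = (\<Prod>i\<in>{1..g-1}. \<Prod>s\<in>{s \<in> S. g - h s = i}. Q (g - h s))"
  proof (rule prod.group[symmetric])
    show "(\<lambda>s. g - h s) ` S \<subseteq> {1..g - 1}" using hpos by (fastforce simp: S_def)
  qed (use fin in \<open>auto simp: S_def\<close>)
  also have "\<dots> = (\<Prod>i=1..g-1. Q i ^ alpha g lam i)"
  proof (rule prod.cong[OF refl])
    fix i assume i: "i \<in> {1..g-1}"
    have "(\<Prod>s\<in>{s \<in> S. g - h s = i}. Q (g - h s)) = (\<Prod>s\<in>{s \<in> S. g - h s = i}. Q i)"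
      by (rule prod.cong) auto
    also have "\<dots> = Q i ^ card {s \<in> S. g - h s = i}" by (rule prod_constant)
    finally have "(\<Prod>s\<in>{s \<in> S. g - h s = i}. Q (g - h s)) = Q i ^ card {s \<in> S. g - h s = i}" .
    moreover have "alpha g lam i = card {s \<in> S. g - h s = i}"
      unfolding alpha_def h_def[symmetric] using i
      by (intro arg_cong[where f = card]) (auto simp: S_def of_nat_diff)
    ultimately show "(\<Prod>s\<in>{s \<in> S. g - h s = i}. Q (g - h s)) = Q i ^ alpha g lam i"
      by (simp only:)
  qed
  finally show ?thesis by (simp add: h_def Q_def)
qed

lemma sum_squares: "6 * (\<Sum>j\<in>{1..t}. (int j)\<^sup>2) = int t * (int t + 1) * (2 * int t + 1)"
proof (induction t)
  case (Suc t)
  have "{1..Suc t} = insert (Suc t) {1..t}" by auto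
  then show ?case using Suc by (simp add: power2_eq_square algebra_simps)
qed simp

theorem theorem4p21:
  fixes t g :: nat and lam :: "nat list" and v :: "int list" and r :: "nat \<Rightarrow> int"
  assumes "t \<ge> 1" and "g = 2 * t"
    and "lam \<in> DD1' g"
    and "v = V_coding g t lam"
    and "\<And>i. 1 \<le> i \<Longrightarrow> i \<le> t \<Longrightarrow> r i = v ! (i - 1) - int (g div 2) + 1"
  shows "((of_nat (sum_list lam) :: rat) =
           1 / of_nat g * (\<Sum>i=1..t. (of_int (r i))\<^sup>2) - (of_nat g + 1) * (of_nat g / 2 + 1) / 12) \<and>
         (\<forall>\<tau> :: int \<Rightarrow> 'a::field. (\<forall>k. \<tau> k \<noteq> 0) \<longrightarrow>
           (\<Prod>s\<in>boxes lam. \<tau> (int (hook_length lam s) - eps s * int g) / \<tau> (int (hook_length lam s))) =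
           (\<Prod>i=1..g-1. (\<tau> (- int i) / \<tau> (int i)) ^ alpha g lam i) *
           (\<Prod>i=1..t. \<tau> (r i) / \<tau> (int i)) *
           (\<Prod>(i, j)\<in>{(i, j). 1 \<le> i \<and> i < j \<and> j \<le> t}.
              \<tau> (r i - r j) / \<tau> (int j - int i) *
              (\<tau> (r i + r j) / \<tau> (int g + 2 - int i - int j))))"
proof -
  note t = assms(1) and g = assms(2)
  define D where "D = pos_beta lam"
  obtain \<rho> where cd: "coded t \<rho> D"
    using DD1'_coded[of lam t] assms by (auto simp: D_def)
  have "lam \<in> DD'" using assms(3) by (simp add: DD1'_def)
  then obtain b where b: "\<And>i j. 1 \<le> i \<Longrightarrow> 1 \<le> j \<Longrightarrow> j \<le> part lam i \<longleftrightarrow> i \<le> b j"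
    "\<And>i. 1 \<le> i \<Longrightarrow> i \<le> b i \<Longrightarrow> b i = part lam i + 1"
    by (rule DD'_parts) blast
  have W: "word lam (y - 1) = 0 \<longleftrightarrow> y \<in> insert 0 (anti D)" for y
    unfolding D_def using b by (rule word_iff_anti)
  have fD: "finite D" unfolding D_def using b by (rule finite_pos_beta)
  have pD: "x > 0" if "x \<in> D" for x using that by (simp add: D_def pos_beta_def)
  have cb: "card (boxes lam) = card (pairs D)" unfolding D_def using b by (rule card_boxes)
  have fb: "finite (boxes lam)"
    using bij_betw_finite[OF bij_boxes_pairs[OF b]] finite_pairs[OF fD] by (simp add: D_def)

  define R where "R = (\<lambda>j. \<bar>\<rho> j\<bar>) ` {1..t}"
  \<comment> \<open>The values left out of the coding: before the shift \<open>f\<close> they are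
    nonpositive, whereas \<open>R\<close> consists of \<open>t\<close> distinct positive
    numbers.\<close>
  define N where "N = insert 0 ((\<lambda>j. - \<bar>\<rho> j\<bar>) ` {1..<t})"
  define f where "f = (\<lambda>x. x + int t - 1)"
  have rj: "2 * int t dvd \<rho> j - int j" if "j \<in> {1..t}" for j using that cd by (auto simp: coded_def)
  have rpos: "\<bar>\<rho> j\<bar> > 0" if "j \<in> {1..t}" for j
  proof -
    have "\<rho> j \<noteq> 0" using rj[OF that] that zdvd_imp_le[of "2 * int t" "int j"] by auto
    then show ?thesis by simp
  qed
  have inj: "inj_on (\<lambda>j. \<bar>\<rho> j\<bar>) {1..t}" using rj by (rule inj_on_abs_coded)
  have Rpos: "x > 0" if "x \<in> R" for x using that rpos by (auto simp: R_def)
  have "inj_on f R" by (rule inj_onI) (simp add: f_def)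
  then have cardfR: "card (f ` R) = t" using card_image[OF inj] by (simp add: R_def card_image)
  have "beta g lam ` {0..<g} = f ` N \<union> f ` R"
    using beta_image_coded[OF cd t W] by (simp add: g f_def N_def R_def image_Un)
  then have v: "v = rev (sorted_list_of_set (f ` R))"
    unfolding assms(4) V_coding_def
  proof -
    have "finite (f ` N)" "finite (f ` R)" by (simp_all add: N_def R_def)
    moreover have "x < y" if "x \<in> f ` N" "y \<in> f ` R" for x y
      using that Rpos by (fastforce simp: N_def f_def)
    ultimately have "take (card (f ` R)) (rev (sorted_list_of_set (f ` N \<union> f ` R))) =
        rev (sorted_list_of_set (f ` R))"
      by (rule take_rev_sorted_list_of_set)
    then show "take t (rev (sorted_list_of_set (beta g lam ` {0..<g}))) = rev (sorted_list_of_set (f ` R))"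
      by (simp only: \<open>beta g lam ` {0..<g} = f ` N \<union> f ` R\<close> cardfR)
  qed
  have r: "r i = v ! (i - 1) - int t + 1" if "i \<in> {1..t}" for i
    using assms(5)[of i] that by (simp add: g)
  have dec: "r j < r i" if "1 \<le> i" "i < j" "j \<le> t" for i j
    using rev_sorted_list_of_set_nth(1)[of "f ` R" i j] that cardfR r[of i] r[of j]
    by (simp add: v R_def)
  have rR: "r ` {1..t} = R"
  proof -
    have "r ` {1..t} = (\<lambda>x. x - int t + 1) ` (\<lambda>i. v ! (i - 1)) ` {1..t}"
      unfolding image_image using r by (intro image_cong) auto
    also have "(\<lambda>i. v ! (i - 1)) ` {1..t} = f ` R"
      using rev_sorted_list_of_set_nth(2)[of "f ` R"] cardfR by (simp add: v R_def)
    finally show ?thesis by (simp add: f_def image_image)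
  qed
  have rp: "r i > 0" if "i \<in> {1..t}" for i using that rR Rpos by blast
  have injr: "inj_on r {1..t}"
    using rR inj by (intro eq_card_imp_inj_on) (simp_all add: R_def card_image)

  show ?thesis
  proof (intro conjI allI impI)
    have "(\<Sum>j\<in>{1..t}. (\<rho> j)\<^sup>2) = (\<Sum>x\<in>R. x\<^sup>2)"
      unfolding R_def using inj by (simp add: sum.reindex)
    also have "\<dots> = (\<Sum>i\<in>{1..t}. (r i)\<^sup>2)"
      unfolding rR[symmetric] using injr by (simp add: sum.reindex)
    finally have sq: "(\<Sum>j\<in>{1..t}. (\<rho> j)\<^sup>2) = (\<Sum>i\<in>{1..t}. (r i)\<^sup>2)" .
    have "2 * int t * int (card (pairs D)) = (\<Sum>j\<in>{1..t}. (\<rho> j)\<^sup>2) - (\<Sum>j\<in>{1..t}. (int j)\<^sup>2)"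
      using coded_pairs[of "\<lambda>_. 1 :: 'a" t D \<rho>] t fD pD cd by simp
    \<comment> \<open>The squares of \<open>1..t\<close> sum to
      \<open>t * (t + 1) * (2 * t + 1) / 6\<close>; division by \<open>g = 2 * t\<close> turns this
      into the constant \<open>(g + 1) * (g / 2 + 1) / 12\<close>.\<close>
    then have "6 * (2 * int t * int (sum_list lam)) =
        6 * (\<Sum>i\<in>{1..t}. (r i)\<^sup>2) - int t * (int t + 1) * (2 * int t + 1)"
      unfolding sq sum_squares[symmetric] sum_list_eq_card_boxes cb by simp
    then have "(of_int (6 * (2 * int t * int (sum_list lam))) :: rat) =
        of_int (6 * (\<Sum>i\<in>{1..t}. (r i)\<^sup>2) - int t * (int t + 1) * (2 * int t + 1))"
      by (rule arg_cong)
    then have "12 * of_nat t * (of_nat (sum_list lam) :: rat) =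
        6 * (\<Sum>i\<in>{1..t}. (of_int (r i))\<^sup>2) - of_nat t * (of_nat t + 1) * (2 * of_nat t + 1)"
      by simp
    then show "(of_nat (sum_list lam) :: rat) =
        1 / of_nat g * (\<Sum>i=1..t. (of_int (r i))\<^sup>2) - (of_nat g + 1) * (of_nat g / 2 + 1) / 12"
      using t by (simp add: g field_simps)
  next
    fix \<tau> :: "int \<Rightarrow> 'a" assume "\<forall>k. \<tau> k \<noteq> 0"
    then have nz: "\<And>k. \<tau> k \<noteq> 0" by simp
    define \<sigma> where "\<sigma> = (\<lambda>k. \<tau> \<bar>k\<bar>)"
    define I where "I = {(i, j). 1 \<le> i \<and> i < j \<and> j \<le> t}"
    \<comment> \<open>The decreasing enumeration of \<open>1..t\<close>, with
      \<open>n i - n j = j - i\<close> and \<open>n i + n j = g + 2 - i - j\<close>: these are the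
      arguments in the denominators.\<close>
    define n where "n = (\<lambda>i. int t + 1 - int i)"
    have "(\<Prod>s\<in>boxes lam. \<sigma> (int (hook_length lam s) - eps s * int g) / \<sigma> (int (hook_length lam s))) =
        pair_prod \<sigma> (int g) D"
      unfolding pair_prod_def D_def using b
      by (rule prod_boxes[where F = "\<lambda>h e. \<sigma> (h - e * int g) / \<sigma> h"])
    moreover have "pair_prod \<sigma> (int g) D * vand \<sigma> {1..int t} = vand \<sigma> R"
      using coded_pairs[of \<sigma> t D \<rho>] t fD pD cd nz by (simp add: \<sigma>_def g R_def)
    moreover have "vand \<sigma> R = (\<Prod>i=1..t. \<tau> (r i)) * (\<Prod>(i, j)\<in>I. \<tau> (r i - r j) * \<tau> (r i + r j))"
    proof -
      have "vand \<sigma> R = (\<Prod>i=1..t. \<sigma> (r i)) * (\<Prod>(i, j)\<in>I. \<sigma> (r i - r j) * \<sigma> (r i + r j))"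
        unfolding rR[symmetric] I_def using dec by (rule vand_enumerate)
      also have "(\<Prod>i=1..t. \<sigma> (r i)) = (\<Prod>i=1..t. \<tau> (r i))"
        using rp by (intro prod.cong) (auto simp: \<sigma>_def less_imp_le)
      also have "(\<Prod>(i, j)\<in>I. \<sigma> (r i - r j) * \<sigma> (r i + r j)) = (\<Prod>(i, j)\<in>I. \<tau> (r i - r j) * \<tau> (r i + r j))"
      proof (rule prod.cong[OF refl], clarify)
        fix i j assume "(i, j) \<in> I"
        then have "r j < r i" "r i > 0" "r j > 0" using dec[of i j] rp[of i] rp[of j] by (auto simp: I_def)
        then show "\<sigma> (r i - r j) * \<sigma> (r i + r j) = \<tau> (r i - r j) * \<tau> (r i + r j)"
          by (simp add: \<sigma>_def)
      qed
      finally show ?thesis .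
    qed
    moreover have "vand \<sigma> {1..int t} = (\<Prod>i=1..t. \<tau> (int i)) *
        (\<Prod>(i, j)\<in>I. \<tau> (int j - int i) * \<tau> (int g + 2 - int i - int j))"
    proof -
      have n: "n ` {1..t} = {1..int t}"
      proof (intro equalityI subsetI)
        fix x assume "x \<in> {1..int t}"
        then have "x = n (nat (int t + 1 - x))" "nat (int t + 1 - x) \<in> {1..t}" by (auto simp: n_def)
        then show "x \<in> n ` {1..t}" by blast
      qed (auto simp: n_def)
      have "vand \<sigma> (n ` {1..t}) = (\<Prod>i=1..t. \<sigma> (n i)) * (\<Prod>(i, j)\<in>I. \<sigma> (n i - n j) * \<sigma> (n i + n j))"
        unfolding I_def by (rule vand_enumerate) (simp add: n_def)
      also have "(\<Prod>i=1..t. \<sigma> (n i)) = (\<Prod>i=1..t. \<tau> (int i))"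
        by (rule prod.reindex_bij_witness[where i = "\<lambda>i. t + 1 - i" and j = "\<lambda>i. t + 1 - i"])
           (auto simp: n_def \<sigma>_def of_nat_diff algebra_simps)
      also have "(\<Prod>(i, j)\<in>I. \<sigma> (n i - n j) * \<sigma> (n i + n j)) =
          (\<Prod>(i, j)\<in>I. \<tau> (int j - int i) * \<tau> (int g + 2 - int i - int j))"
      proof (rule prod.cong[OF refl], clarify)
        fix i j assume "(i, j) \<in> I"
        then have "n i - n j = int j - int i" "n i + n j = int g + 2 - int i - int j"
          "int j - int i \<ge> 0" "int g + 2 - int i - int j \<ge> 0" by (auto simp: I_def n_def g)
        then show "\<sigma> (n i - n j) * \<sigma> (n i + n j) = \<tau> (int j - int i) * \<tau> (int g + 2 - int i - int j)"
          by (simp add: \<sigma>_def)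
      qed
      finally show ?thesis unfolding n .
    qed
    moreover have "(\<Prod>(i, j)\<in>I. \<tau> (int j - int i) * \<tau> (int g + 2 - int i - int j)) \<noteq> 0"
    proof -
      have "I \<subseteq> {1..t} \<times> {1..t}" by (auto simp: I_def)
      then have "finite I" by (rule finite_subset) auto
      then show ?thesis using nz by (auto simp: prod_zero_iff)
    qed
    moreover have "(\<Prod>i=1..t. \<tau> (int i)) \<noteq> 0" using nz by (simp add: prod_zero_iff)
    ultimately have "(\<Prod>s\<in>boxes lam. \<sigma> (int (hook_length lam s) - eps s * int g) / \<sigma> (int (hook_length lam s))) =
        (\<Prod>i=1..t. \<tau> (r i)) / (\<Prod>i=1..t. \<tau> (int i)) *
        ((\<Prod>(i, j)\<in>I. \<tau> (r i - r j) * \<tau> (r i + r j)) /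
         (\<Prod>(i, j)\<in>I. \<tau> (int j - int i) * \<tau> (int g + 2 - int i - int j)))"
      by (simp add: divide_simps)
    also have "\<dots> = (\<Prod>i=1..t. \<tau> (r i) / \<tau> (int i)) * (\<Prod>(i, j)\<in>I.
        \<tau> (r i - r j) / \<tau> (int j - int i) * (\<tau> (r i + r j) / \<tau> (int g + 2 - int i - int j)))"
      unfolding prod_dividef[symmetric] by (simp add: case_prod_unfold)
    finally show "(\<Prod>s\<in>boxes lam. \<tau> (int (hook_length lam s) - eps s * int g) / \<tau> (int (hook_length lam s))) =
           (\<Prod>i=1..g-1. (\<tau> (- int i) / \<tau> (int i)) ^ alpha g lam i) *
           (\<Prod>i=1..t. \<tau> (r i) / \<tau> (int i)) *
           (\<Prod>(i, j)\<in>{(i, j). 1 \<le> i \<and> i < j \<and> j \<le> t}.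
              \<tau> (r i - r j) / \<tau> (int j - int i) *
              (\<tau> (r i + r j) / \<tau> (int g + 2 - int i - int j)))"
      unfolding prod_hook_abs[of \<tau>, OF nz fb] I_def[symmetric] \<sigma>_def by (simp only: mult.assoc)
  qed
qed

end
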